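(* Define the scalar random variables $$Z_{tj}^\mu:=\langle F_t-\mathbb{E}F_0,\varphi_j^\mu\rangle_\mu,\qquad j\in\mathbb{N},\ t=0,1,\dots$$ If $\mu$ is a diffraction of $(\xi_t)$, then: (i) $\mathbb{E}Z_{tj}^\mu=0$ for all $t$ and all $j$; (ii) $\mathrm{Var}(Z_{tj}^\mu)=\lambda_j^\mu$ for all $t$ and all $j$; (iii) for all $t$, $\mathrm{Cov}(Z_{ti}^\mu,Z_{tj}^\mu)=0$ whenever $i\ne j$; (iv) for each $j$, the function $\varphi_j^\mu$ is bounded and càdlàg. Moreover, for each $t$ the expansion $$F_t=\mathbb{E}F_0+\sum_{j=1}^\infty Z_{tj}^\mu\varphi_j^\mu$$ holds in $L^2(\mu)$, almost surely.
   Context: Let $(\Omega,\mathscr{A},\mathbb{P})$ be a probability space and $M_1(\mathbb{R})$ the set of Borel probability measures on $\mathbb{R}$ with the topology of weak convergence. Standing assumption: $(\xi_t:t=0,1,\dots)$ is a stationary sequence of random elements of $M_1(\mathbb{R})$. The baricenter $\mathbb{E}\xi_0$ is the unique element of $M_1(\mathbb{R})$ with $\mathbb{E}\int f\,d\xi_0=\int f\,d\mathbb{E}\xi_0$ for all continuous bounded $f$. A finite Borel measure $\mu$ on $\mathbb{R}$ is a diffraction of $(\xi_t)$ if it is equivalent to Lebesgue measure on some interval containing the support of $\mathbb{E}\xi_0$. $\langle\cdot,\cdot\rangle_\mu$ and $\|\cdot\|_\mu$ are the inner product and norm of $L^2(\mu)$. For $x,y\in\mathbb{R}$ put $F_t(x):=\xi_t(-\infty,x]$,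 $\mathbb{E}F_0(x):=\mathbb{E}\xi_0(-\infty,x]$, $C_0(x,y):=\mathrm{Cov}(F_0(x),F_0(y))$, and let $C_0^\mu$ be the operator on $L^2(\mu)$ given by $C_0^\mu f(x):=\int C_0(x,y)f(y)\,\mu(dy)$ (positive and trace-class). Let $(\lambda_j^\mu:j\in\mathbb{N})$ be the non-increasing sequence of eigenvalues of $C_0^\mu$ (with repetitions, if any), with the convention that it contains zeros if and only if $C_0^\mu$ has finite rank; the eigenfunctions $\varphi_j^\mu$ are defined by $C_0^\mu\varphi_j^\mu=\lambda_j^\mu\varphi_j^\mu$, $j\in\mathbb{N}$, and the set $\{\varphi_j^\mu:j\in\mathbb{N}\}$ is assumed orthonormal in $L^2(\mu)$.
   Formalization: In (iv), φ_j has a bounded càdlàg version (equal μ-a.e.) when λ_j ≠ 0; when λ_j = 0 (finite rank), where arbitrary orthonormal kernel elements need not be bounded or càdlàg, it is only claimed that the eigenfunctions can be chosen bounded and càdlàg. *)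

theory Defs
  imports "HOL-Probability.Probability"
begin

text \<open>Random probability measures. Here \<open>P\<close> is the underlying probability space and
  \<open>\<xi> t \<omega>\<close> is the realisation at \<open>\<omega>\<close> of the random measure at time \<open>t\<close>.\<close>

text \<open>The coarsest topology on the Borel probability measures on the line that makes
  \<open>\<nu> \<mapsto> \<integral>f d\<nu>\<close> continuous for every bounded continuous \<open>f\<close>. Choosing \<open>f = 0\<close>, \<open>U = UNIV\<close>
  shows that its underlying set is \<open>Collect real_distribution\<close>.\<close>

definition weak_topology :: "real measure topology" where
  "weak_topology = topology_generated_by
     {{\<nu>. real_distribution \<nu> \<and> (\<integral>x. f x \<partial>\<nu>) \<in> U} | (f :: real \<Rightarrow> real) (U :: real set).
        continuous_on UNIV f \<and> bounded (range f) \<and> open U}"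

definition M1 :: "real measure measure" where
  "M1 = sigma (Collect real_distribution) {U. openin weak_topology U}"

definition stationary_random_measures :: "'a measure \<Rightarrow> (nat \<Rightarrow> 'a \<Rightarrow> real measure) \<Rightarrow> bool" where
  "stationary_random_measures P \<xi> \<longleftrightarrow>
     (\<forall>t. \<xi> t \<in> measurable P M1) \<and>
     (\<forall>h. distr P (PiM UNIV (\<lambda>_. M1)) (\<lambda>\<omega> t. \<xi> (t + h) \<omega>)
        = distr P (PiM UNIV (\<lambda>_. M1)) (\<lambda>\<omega> t. \<xi> t \<omega>))"

definition baricenter :: "'a measure \<Rightarrow> ('a \<Rightarrow> real measure) \<Rightarrow> real measure" where
  "baricenter P \<zeta> = (THE \<nu>. real_distribution \<nu> \<and>
     (\<forall>f :: real \<Rightarrow> real. continuous_on UNIV f \<and> bounded (range f) \<longrightarrow>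
        (\<integral>\<omega>. (\<integral>x. f x \<partial>(\<zeta> \<omega>)) \<partial>P) = (\<integral>x. f x \<partial>\<nu>)))"

definition measure_support :: "real measure \<Rightarrow> real set" where
  "measure_support \<nu> = {x. \<forall>U. open U \<and> x \<in> U \<longrightarrow> emeasure \<nu> U > 0}"

definition diffraction :: "'a measure \<Rightarrow> (nat \<Rightarrow> 'a \<Rightarrow> real measure) \<Rightarrow> real measure \<Rightarrow> bool" where
  "diffraction P \<xi> \<mu> \<longleftrightarrow>
     finite_measure \<mu> \<and> sets \<mu> = sets borel \<and>
     (\<exists>I. is_interval I \<and> measure_support (baricenter P (\<xi> 0)) \<subseteq> I \<and>
        absolutely_continuous \<mu> (density lborel (indicator I)) \<and>
        absolutely_continuous (density lborel (indicator I)) \<mu>)"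

text \<open>Elements of the real space \<open>L\<^sup>2(\<mu>)\<close> are represented by functions, and equality in
  \<open>L\<^sup>2(\<mu>)\<close> by equality \<open>\<mu>\<close>-almost everywhere.\<close>

definition L2 :: "real measure \<Rightarrow> (real \<Rightarrow> real) set" where
  "L2 \<mu> = {f \<in> borel_measurable \<mu>. integrable \<mu> (\<lambda>x. (f x)\<^sup>2)}"

definition L2_inner :: "real measure \<Rightarrow> (real \<Rightarrow> real) \<Rightarrow> (real \<Rightarrow> real) \<Rightarrow> real" where
  "L2_inner \<mu> f g = (\<integral>x. f x * g x \<partial>\<mu>)"

definition L2_norm :: "real measure \<Rightarrow> (real \<Rightarrow> real) \<Rightarrow> real" where
  "L2_norm \<mu> f = sqrt (L2_inner \<mu> f f)"

definition L2_sums :: "real measure \<Rightarrow> (nat \<Rightarrow> real \<Rightarrow> real) \<Rightarrow> (real \<Rightarrow> real) \<Rightarrow> bool" where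
  "L2_sums \<mu> f s \<longleftrightarrow> (\<forall>j. f j \<in> L2 \<mu>) \<and> s \<in> L2 \<mu> \<and>
     (\<lambda>n. L2_norm \<mu> (\<lambda>x. s x - (\<Sum>j<n. f j x))) \<longlonglongrightarrow> 0"

definition covariance :: "'a measure \<Rightarrow> ('a \<Rightarrow> real) \<Rightarrow> ('a \<Rightarrow> real) \<Rightarrow> real" where
  "covariance P X Y = prob_space.expectation P
     (\<lambda>\<omega>. (X \<omega> - prob_space.expectation P X) * (Y \<omega> - prob_space.expectation P Y))"

definition C0 :: "'a measure \<Rightarrow> (nat \<Rightarrow> 'a \<Rightarrow> real measure) \<Rightarrow> real \<Rightarrow> real \<Rightarrow> real" where
  "C0 P \<xi> x y = covariance P (\<lambda>\<omega>. cdf (\<xi> 0 \<omega>) x) (\<lambda>\<omega>. cdf (\<xi> 0 \<omega>) y)"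

definition C0_op ::
  "'a measure \<Rightarrow> (nat \<Rightarrow> 'a \<Rightarrow> real measure) \<Rightarrow> real measure \<Rightarrow> (real \<Rightarrow> real) \<Rightarrow> real \<Rightarrow> real" where
  "C0_op P \<xi> \<mu> f x = (\<integral>y. C0 P \<xi> x y * f y \<partial>\<mu>)"

text \<open>The zero function is admitted here; nontriviality of the eigenfunctions used below comes
  from orthonormality.\<close>

definition eigenspace ::
  "'a measure \<Rightarrow> (nat \<Rightarrow> 'a \<Rightarrow> real measure) \<Rightarrow> real measure \<Rightarrow> real \<Rightarrow> (real \<Rightarrow> real) set" where
  "eigenspace P \<xi> \<mu> c = {f \<in> L2 \<mu>. AE x in \<mu>. C0_op P \<xi> \<mu> f x = c * f x}"

definition C0_finite_rank ::
  "'a measure \<Rightarrow> (nat \<Rightarrow> 'a \<Rightarrow> real measure) \<Rightarrow> real measure \<Rightarrow> bool" where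
  "C0_finite_rank P \<xi> \<mu> \<longleftrightarrow>
     (\<exists>n g. (\<forall>i<n. g i \<in> L2 \<mu>) \<and>
        (\<forall>f\<in>L2 \<mu>. \<exists>a. AE x in \<mu>. C0_op P \<xi> \<mu> f x = (\<Sum>i<(n::nat). a i * g i x)))"

text \<open>The penultimate condition says that a nonzero eigenvalue is listed as often as its
  multiplicity: its eigenspace is spanned by the \<open>\<phi> j\<close> that belong to it. The kernel need not be
  exhausted: if some \<open>lam j\<close> vanish, the corresponding \<open>\<phi> j\<close> are arbitrary orthonormal kernel
  elements, so they need not have any regularity. Indices start at 0 instead of 1.\<close>

definition eigensystem ::
  "'a measure \<Rightarrow> (nat \<Rightarrow> 'a \<Rightarrow> real measure) \<Rightarrow> real measure \<Rightarrow>
    (nat \<Rightarrow> real) \<Rightarrow> (nat \<Rightarrow> real \<Rightarrow> real) \<Rightarrow> bool" where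
  "eigensystem P \<xi> \<mu> lam \<phi> \<longleftrightarrow>
     decseq lam \<and>
     (\<forall>j. \<phi> j \<in> eigenspace P \<xi> \<mu> (lam j)) \<and>
     (\<forall>i j. L2_inner \<mu> (\<phi> i) (\<phi> j) = (if i = j then 1 else 0)) \<and>
     (\<forall>c f. c \<noteq> 0 \<and> f \<in> eigenspace P \<xi> \<mu> c \<longrightarrow>
        (\<exists>J a. finite J \<and> J \<subseteq> {j. lam j = c} \<and> (AE x in \<mu>. f x = (\<Sum>j\<in>J. a j * \<phi> j x)))) \<and>
     ((\<exists>j. lam j = 0) \<longleftrightarrow> C0_finite_rank P \<xi> \<mu>)"

definition Z ::
  "'a measure \<Rightarrow> (nat \<Rightarrow> 'a \<Rightarrow> real measure) \<Rightarrow> real measure \<Rightarrow> (nat \<Rightarrow> real \<Rightarrow> real) \<Rightarrow>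
    nat \<Rightarrow> nat \<Rightarrow> 'a \<Rightarrow> real" where
  "Z P \<xi> \<mu> \<phi> t j \<omega> =
     L2_inner \<mu> (\<lambda>x. cdf (\<xi> t \<omega>) x - cdf (baricenter P (\<xi> 0)) x) (\<phi> j)"

definition cadlag :: "(real \<Rightarrow> real) \<Rightarrow> bool" where
  "cadlag f \<longleftrightarrow> (\<forall>x. continuous (at_right x) f \<and> (\<exists>l. (f \<longlongrightarrow> l) (at_left x)))"

end

theory Submission
  imports Defs "HOL-Computational_Algebra.Polynomial"
begin

text \<open>The sequence enters only through the law of a single \<open>\<xi> t\<close>, which by stationarity does not
  depend on \<open>t\<close>. Write \<open>X = F - G\<close> for the centred distribution function, \<open>G\<close> being the
  distribution function of the baricenter, and \<open>T\<close> for the integral operator on \<open>L\<^sup>2(\<mu>)\<close> whose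
  kernel is the covariance of \<open>X\<close>. Fubini's theorem gives \<open>T f x = E (X x * \<langle>X, f\<rangle>)\<close> and
  \<open>\<langle>T f, g\<rangle> = E (\<langle>X, f\<rangle> * \<langle>X, g\<rangle>)\<close> (\<open>T_eq_expectation_X\<close>, \<open>T_inner\<close>). The mean, variance and
  covariance of the coefficients follow from the eigenvalue equation and orthonormality.

  The first formula also shows that every \<open>T f\<close> is a difference of two bounded, nondecreasing,
  right-continuous functions (\<open>T_decomposition\<close>). Hence \<open>T f\<close> is bounded and cadlag, and so is an
  eigenfunction for a nonzero eigenvalue, after division by the eigenvalue. Helly's selection
  theorem turns the same fact into compactness of \<open>T\<close> (\<open>T_compact\<close>): monotone functions converge off
  a countable set, and such a set is \<open>\<mu>\<close>-null because \<open>\<mu>\<close> is dominated by Lebesgue measure.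

  Compactness makes the supremum of \<open>\<langle>T f, f\<rangle>\<close> over unit vectors orthogonal to
  \<open>\<phi> 0, \<dots>, \<phi> (n - 1)\<close>, if it is positive, an eigenvalue whose eigenvector has the same
  orthogonality. As every nonzero eigenvalue is listed with its full multiplicity in decreasing
  order, the supremum is at most \<open>lam n\<close> (\<open>Rayleigh_bound\<close>).

  For the expansion let \<open>R n\<close> be \<open>X\<close> minus the first \<open>n\<close> terms of the series. The Rayleigh bound gives
  \<open>E \<langle>R n, g\<rangle>\<^sup>2 \<le> lam n * \<langle>g, g\<rangle>\<close> for each fixed \<open>g\<close>, and Bessel's inequality gives
  \<open>lam n \<longlonglongrightarrow> 0\<close>. Since \<open>X\<close> is right-continuous, it is approximated in mean square by step functions
  built from finitely many fixed indicators with coefficients bounded by 1. Testing \<open>R n\<close> against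
  these indicators yields \<open>E \<langle>R n, R n\<rangle> \<longlonglongrightarrow> 0\<close>. The norms \<open>\<langle>R n, R n\<rangle>\<close> decrease in \<open>n\<close>, so they tend to
  zero almost surely (\<open>defect_AE_lim\<close>).

  If some eigenvalue vanishes, the corresponding eigenfunctions have to be replaced by bounded
  cadlag ones. Polynomials in \<open>arctan\<close> orthogonal to the functions already chosen serve for this
  purpose; they lie in the kernel of \<open>T\<close> by the Rayleigh bound with \<open>lam n = 0\<close>.\<close>

section \<open>Random measures, baricenters and stationarity\<close>

lemma openin_weak_topology_subset:
  assumes "openin weak_topology U"
  shows "U \<subseteq> Collect real_distribution"
  using openin_subset[OF assms] by (auto simp: weak_topology_def)

lemma space_M1: "space M1 = Collect real_distribution"
  by (simp add: M1_def space_measure_of_conv)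

lemma openin_weak_topology_in_sets_M1: "openin weak_topology U \<Longrightarrow> U \<in> sets M1"
  unfolding M1_def
  by (rule in_measure_of) (use openin_weak_topology_subset in auto)

lemma integral_measurable_M1:
  fixes f :: "real \<Rightarrow> real"
  assumes "continuous_on UNIV f" "bounded (range f)"
  shows "(\<lambda>\<nu>. \<integral>x. f x \<partial>\<nu>) \<in> borel_measurable M1"
proof (rule borel_measurableI)
  fix U :: "real set" assume "open U"
  have "(\<lambda>\<nu>. \<integral>x. f x \<partial>\<nu>) -` U \<inter> space M1 = {\<nu>. real_distribution \<nu> \<and> (\<integral>x. f x \<partial>\<nu>) \<in> U}"
    by (auto simp: space_M1)
  moreover have "openin weak_topology {\<nu>. real_distribution \<nu> \<and> (\<integral>x. f x \<partial>\<nu>) \<in> U}"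
    unfolding weak_topology_def
    by (rule topology_generated_by_Basis) (use assms \<open>open U\<close> in blast)
  ultimately show "(\<lambda>\<nu>. \<integral>x. f x \<partial>\<nu>) -` U \<inter> space M1 \<in> sets M1"
    using openin_weak_topology_in_sets_M1 by simp
qed

lemma continuous_on_cts_step: "a < b \<Longrightarrow> continuous_on UNIV (cts_step a b)"
  by (rule uniformly_continuous_imp_continuous[OF cts_step_uniformly_continuous])

lemma bounded_range_cts_step: "a < b \<Longrightarrow> bounded (range (cts_step a b))"
  by (rule boundedI[of _ 1]) (auto simp: cts_step_def)

text \<open>Values of a distribution function are limits of integrals of bounded continuous functions.
  Hence they are measurable on \<open>M1\<close>, and the distribution function of a baricenter is the
  expected distribution function.\<close>

lemma cdf_eq_lim_cts_step:
  assumes "real_distribution \<nu>"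
  shows "(\<lambda>n. \<integral>y. cts_step x (x + 1 / real (Suc n)) y \<partial>\<nu>) \<longlonglongrightarrow> cdf \<nu> x"
proof (rule tendsto_sandwich)
  interpret real_distribution \<nu> by fact
  show "\<forall>\<^sub>F n in sequentially. cdf \<nu> x \<le> (\<integral>y. cts_step x (x + 1 / real (Suc n)) y \<partial>\<nu>)"
    by (intro always_eventually allI cdf_cts_step) simp
  show "\<forall>\<^sub>F n in sequentially. (\<integral>y. cts_step x (x + 1 / real (Suc n)) y \<partial>\<nu>) \<le> cdf \<nu> (x + 1 / real (Suc n))"
    by (intro always_eventually allI cdf_cts_step) simp
  have "(\<lambda>n. x + 1 / real (Suc n)) \<longlonglongrightarrow> x + 0"
    using LIMSEQ_inverse_real_of_nat by (intro tendsto_intros) (simp add: divide_inverse)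
  then have "filterlim (\<lambda>n. x + 1 / real (Suc n)) (at_right x) sequentially"
    by (simp add: filterlim_at)
  then show "(\<lambda>n. cdf \<nu> (x + 1 / real (Suc n))) \<longlonglongrightarrow> cdf \<nu> x"
    using cdf_is_right_cont[of x] unfolding continuous_within by (rule filterlim_compose[rotated])
qed auto

lemma real_distribution_eqI_continuous:
  assumes "real_distribution \<nu>" "real_distribution \<nu>'"
    and "\<And>f :: real \<Rightarrow> real. continuous_on UNIV f \<Longrightarrow> bounded (range f) \<Longrightarrow>
           (\<integral>x. f x \<partial>\<nu>) = (\<integral>x. f x \<partial>\<nu>')"
  shows "\<nu> = \<nu>'"
proof (rule cdf_unique[OF assms(1,2)], rule ext)
  fix x
  have "(\<lambda>n. \<integral>y. cts_step x (x + 1 / real (Suc n)) y \<partial>\<nu>) = (\<lambda>n. \<integral>y. cts_step x (x + 1 / real (Suc n)) y \<partial>\<nu>')"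
    by (intro ext assms(3) continuous_on_cts_step bounded_range_cts_step) simp_all
  then show "cdf \<nu> x = cdf \<nu>' x"
    using cdf_eq_lim_cts_step[OF assms(1), of x] cdf_eq_lim_cts_step[OF assms(2), of x]
    by (metis LIMSEQ_unique)
qed

lemma cdf_measurable_M1: "(\<lambda>\<nu>. cdf \<nu> x) \<in> borel_measurable M1"
proof (rule borel_measurable_LIMSEQ_real)
  show "(\<lambda>\<nu>. \<integral>y. cts_step x (x + 1 / real (Suc n)) y \<partial>\<nu>) \<in> borel_measurable M1" for n
    by (intro integral_measurable_M1 continuous_on_cts_step bounded_range_cts_step) simp_all
  show "(\<lambda>n. \<integral>y. cts_step x (x + 1 / real (Suc n)) y \<partial>\<nu>) \<longlonglongrightarrow> cdf \<nu> x" if "\<nu> \<in> space M1" for \<nu>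
    using that by (intro cdf_eq_lim_cts_step) (simp add: space_M1)
qed

lemma random_measure_real_distribution:
  "\<zeta> \<in> measurable P M1 \<Longrightarrow> \<omega> \<in> space P \<Longrightarrow> real_distribution (\<zeta> \<omega>)"
  using measurable_space[of \<zeta> P M1] by (simp add: space_M1)

text \<open>A random measure is a probability kernel, so that averaging it over \<open>P\<close> is the bind
  operation of the Giry monad; this constructs the baricenter.\<close>

lemma random_measure_kernel:
  assumes "\<zeta> \<in> measurable P M1"
  shows "\<zeta> \<in> measurable P (subprob_algebra borel)"
proof (rule measurable_subprob_algebra_generated)
  show "sets borel = sigma_sets UNIV (range (atMost :: real \<Rightarrow> _))"
    by (subst borel_eq_atMost) (rule sets_measure_of, simp)
  show "Int_stable (range (atMost :: real \<Rightarrow> _))"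
    by (auto simp: Int_stable_def)
  fix \<omega> assume "\<omega> \<in> space P"
  then interpret real_distribution "\<zeta> \<omega>"
    by (rule random_measure_real_distribution[OF assms])
  show "subprob_space (\<zeta> \<omega>)" "sets (\<zeta> \<omega>) = sets borel"
    by (simp_all add: prob_space_imp_subprob_space prob_space_axioms)
next
  have cdf: "(\<lambda>\<omega>. cdf (\<zeta> \<omega>) x) \<in> borel_measurable P" for x
    using assms cdf_measurable_M1 by (rule measurable_compose)
  fix A assume "A \<in> range (atMost :: real \<Rightarrow> _)"
  then obtain x where A: "A = {..x}" by auto
  have "(\<lambda>\<omega>. ennreal (cdf (\<zeta> \<omega>) x)) \<in> borel_measurable P"
    using cdf by measurable
  moreover have "ennreal (cdf (\<zeta> \<omega>) x) = emeasure (\<zeta> \<omega>) A" if "\<omega> \<in> space P" for \<omega>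
  proof -
    interpret real_distribution "\<zeta> \<omega>"
      using that by (rule random_measure_real_distribution[OF assms])
    show ?thesis by (simp add: A cdf_def emeasure_eq_measure)
  qed
  ultimately show "(\<lambda>\<omega>. emeasure (\<zeta> \<omega>) A) \<in> borel_measurable P"
    by (simp cong: measurable_cong)
next
  have "emeasure (\<zeta> \<omega>) UNIV = 1" if "\<omega> \<in> space P" for \<omega>
  proof -
    interpret real_distribution "\<zeta> \<omega>"
      using that by (rule random_measure_real_distribution[OF assms])
    show ?thesis using emeasure_space_1 by simp
  qed
  then show "(\<lambda>\<omega>. emeasure (\<zeta> \<omega>) UNIV) \<in> borel_measurable P"
    by (simp cong: measurable_cong)
qed simp

lemma (in prob_space) baricenter_properties:
  fixes f :: "real \<Rightarrow> real"
  assumes \<zeta>: "\<zeta> \<in> measurable M M1"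
  shows "real_distribution (baricenter M \<zeta>)"
    and "continuous_on UNIV f \<Longrightarrow> bounded (range f) \<Longrightarrow>
      expectation (\<lambda>\<omega>. \<integral>x. f x \<partial>(\<zeta> \<omega>)) = (\<integral>x. f x \<partial>(baricenter M \<zeta>))"
proof -
  note kernel = random_measure_kernel[OF \<zeta>]
  define \<nu> where "\<nu> = M \<bind> \<zeta>"
  have sets: "sets \<nu> = sets borel"
    unfolding \<nu>_def by (rule sets_bind[OF sets_kernel[OF kernel] not_empty])
  have "prob_space \<nu>"
    unfolding \<nu>_def
    by (rule prob_space_bind[OF _ kernel])
      (auto intro!: AE_I2 dest: random_measure_real_distribution[OF \<zeta>] simp: real_distribution_def)
  then have rd: "real_distribution \<nu>"
    by (simp add: real_distribution_def real_distribution_axioms_def sets)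
  interpret \<nu>: real_distribution \<nu> by fact
  have int: "expectation (\<lambda>\<omega>. \<integral>x. f x \<partial>(\<zeta> \<omega>)) = (\<integral>x. f x \<partial>\<nu>)"
    if cont: "continuous_on UNIV f" and bdd: "bounded (range f)" for f :: "real \<Rightarrow> real"
  proof -
    obtain B where B: "\<And>x. \<bar>f x\<bar> \<le> B" using bdd unfolding bounded_iff by auto
    have f[measurable]: "f \<in> borel_measurable borel"
      by (rule borel_measurable_continuous_onI[OF cont])
    \<comment> \<open>Adding the bound makes the integrand nonnegative, as the nonnegative integral over a bind requires.\<close>
    have shift: "integrable \<eta> f" "(\<integral>x. f x \<partial>\<eta>) + B = (\<integral>x. f x + B \<partial>\<eta>)"
        "ennreal ((\<integral>x. f x \<partial>\<eta>) + B) = (\<integral>\<^sup>+x. ennreal (f x + B) \<partial>\<eta>)" "\<bar>\<integral>x. f x \<partial>\<eta>\<bar> \<le> B"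
      if "real_distribution \<eta>" for \<eta>
    proof -
      interpret \<eta>: real_distribution \<eta> by fact
      show i: "integrable \<eta> f"
        by (rule \<eta>.integrable_const_bound[of _ B]) (use B in auto)
      show e: "(\<integral>x. f x \<partial>\<eta>) + B = (\<integral>x. f x + B \<partial>\<eta>)"
        using i by (simp add: \<eta>.prob_space[simplified])
      have nn: "0 \<le> f x + B" for x using B[of x] by linarith
      show "ennreal ((\<integral>x. f x \<partial>\<eta>) + B) = (\<integral>\<^sup>+x. ennreal (f x + B) \<partial>\<eta>)"
        unfolding e by (rule nn_integral_eq_integral[symmetric]) (use i nn in auto)
      have "\<bar>\<integral>x. f x \<partial>\<eta>\<bar> \<le> (\<integral>x. \<bar>f x\<bar> \<partial>\<eta>)"
        by (rule integral_abs_bound)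
      also have "\<dots> \<le> (\<integral>x. B \<partial>\<eta>)"
        by (rule integral_mono) (use i B in auto)
      finally show "\<bar>\<integral>x. f x \<partial>\<eta>\<bar> \<le> B"
        by (simp add: \<eta>.prob_space[simplified])
    qed
    have rdz: "real_distribution (\<zeta> \<omega>)" if "\<omega> \<in> space M" for \<omega>
      using random_measure_real_distribution[OF \<zeta> that] .
    have meas: "(\<lambda>\<omega>. \<integral>x. f x \<partial>(\<zeta> \<omega>)) \<in> borel_measurable M"
      using \<zeta> integral_measurable_M1[OF cont bdd] by (rule measurable_compose)
    have i': "integrable M (\<lambda>\<omega>. \<integral>x. f x \<partial>(\<zeta> \<omega>))"
      by (rule integrable_const_bound[of _ B]) (use shift(4) rdz meas in auto)
    have "ennreal (expectation (\<lambda>\<omega>. \<integral>x. f x \<partial>(\<zeta> \<omega>)) + B) = ennreal (expectation (\<lambda>\<omega>. (\<integral>x. f x \<partial>(\<zeta> \<omega>)) + B))"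
      using i' by (simp add: prob_space)
    also have "\<dots> = (\<integral>\<^sup>+\<omega>. ennreal ((\<integral>x. f x \<partial>(\<zeta> \<omega>)) + B) \<partial>M)"
      by (rule nn_integral_eq_integral[symmetric]) (use i' shift(4)[OF rdz] in \<open>auto intro!: AE_I2 simp: abs_le_iff, fastforce\<close>)
    also have "\<dots> = (\<integral>\<^sup>+\<omega>. \<integral>\<^sup>+x. ennreal (f x + B) \<partial>(\<zeta> \<omega>) \<partial>M)"
      by (rule nn_integral_cong) (rule shift(3)[OF rdz])
    also have "\<dots> = (\<integral>\<^sup>+x. ennreal (f x + B) \<partial>\<nu>)"
      unfolding \<nu>_def by (rule nn_integral_bind[OF _ kernel, symmetric]) simp
    also have "\<dots> = ennreal ((\<integral>x. f x \<partial>\<nu>) + B)"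
      by (rule shift(3)[OF rd, symmetric])
    finally have *: "ennreal (expectation (\<lambda>\<omega>. \<integral>x. f x \<partial>(\<zeta> \<omega>)) + B) = ennreal ((\<integral>x. f x \<partial>\<nu>) + B)" .
    have "0 \<le> expectation (\<lambda>\<omega>. (\<integral>x. f x \<partial>(\<zeta> \<omega>)) + B)"
      by (rule integral_nonneg_AE) (use shift(4)[OF rdz] in \<open>auto intro!: AE_I2 simp: abs_le_iff, fastforce\<close>)
    then have "0 \<le> expectation (\<lambda>\<omega>. \<integral>x. f x \<partial>(\<zeta> \<omega>)) + B"
      using i' by (simp add: prob_space)
    moreover have "0 \<le> (\<integral>x. f x \<partial>\<nu>) + B"
      using shift(4)[OF rd] by linarith
    ultimately show ?thesis
      using * by (simp add: ennreal_inj)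
  qed
  have bar: "baricenter M \<zeta> = \<nu>"
    unfolding baricenter_def
  proof (rule the_equality)
    show "real_distribution \<nu> \<and> (\<forall>f :: real \<Rightarrow> real. continuous_on UNIV f \<and> bounded (range f) \<longrightarrow>
        expectation (\<lambda>\<omega>. \<integral>x. f x \<partial>(\<zeta> \<omega>)) = (\<integral>x. f x \<partial>\<nu>))"
      using rd int by blast
  next
    fix \<nu>' assume *: "real_distribution \<nu>' \<and> (\<forall>f :: real \<Rightarrow> real. continuous_on UNIV f \<and> bounded (range f) \<longrightarrow>
        expectation (\<lambda>\<omega>. \<integral>x. f x \<partial>(\<zeta> \<omega>)) = (\<integral>x. f x \<partial>\<nu>'))"
    show "\<nu>' = \<nu>"
      by (rule real_distribution_eqI_continuous) (use * rd int in auto)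
  qed
  show "real_distribution (baricenter M \<zeta>)" unfolding bar by fact
  show "expectation (\<lambda>\<omega>. \<integral>x. f x \<partial>(\<zeta> \<omega>)) = (\<integral>x. f x \<partial>(baricenter M \<zeta>))"
    if "continuous_on UNIV f" "bounded (range f)"
    unfolding bar by (rule int[OF that])
qed

lemma (in prob_space) cdf_baricenter:
  assumes \<zeta>: "\<zeta> \<in> measurable M M1"
  shows "cdf (baricenter M \<zeta>) x = expectation (\<lambda>\<omega>. cdf (\<zeta> \<omega>) x)"
proof (rule LIMSEQ_unique)
  let ?s = "\<lambda>n. cts_step x (x + 1 / real (Suc n))"
  note bar = baricenter_properties[OF \<zeta>]
  show "(\<lambda>n. \<integral>y. ?s n y \<partial>(baricenter M \<zeta>)) \<longlonglongrightarrow> cdf (baricenter M \<zeta>) x"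
    by (rule cdf_eq_lim_cts_step[OF bar(1)])
  have eq: "(\<integral>y. ?s n y \<partial>(baricenter M \<zeta>)) = expectation (\<lambda>\<omega>. \<integral>y. ?s n y \<partial>(\<zeta> \<omega>))" for n
    by (intro bar(2)[symmetric] continuous_on_cts_step bounded_range_cts_step) simp_all
  have bnd: "\<bar>\<integral>y. ?s n y \<partial>(\<zeta> \<omega>)\<bar> \<le> 1" if "\<omega> \<in> space M" for n \<omega>
  proof -
    interpret \<zeta>: real_distribution "\<zeta> \<omega>"
      using that by (rule random_measure_real_distribution[OF \<zeta>])
    have "0 \<le> cdf (\<zeta> \<omega>) x" "cdf (\<zeta> \<omega>) x \<le> (\<integral>y. ?s n y \<partial>(\<zeta> \<omega>))"
      "(\<integral>y. ?s n y \<partial>(\<zeta> \<omega>)) \<le> cdf (\<zeta> \<omega>) (x + 1 / real (Suc n))" "cdf (\<zeta> \<omega>) (x + 1 / real (Suc n)) \<le> 1"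
      by (intro \<zeta>.cdf_nonneg \<zeta>.cdf_cts_step \<zeta>.cdf_bounded_prob; simp)+
    then show ?thesis by linarith
  qed
  show "(\<lambda>n. \<integral>y. ?s n y \<partial>(baricenter M \<zeta>)) \<longlonglongrightarrow> expectation (\<lambda>\<omega>. cdf (\<zeta> \<omega>) x)"
    unfolding eq
  proof (rule integral_dominated_convergence[where w = "\<lambda>_. 1"])
    show "(\<lambda>\<omega>. cdf (\<zeta> \<omega>) x) \<in> borel_measurable M"
      using \<zeta> cdf_measurable_M1 by (rule measurable_compose)
    show "(\<lambda>\<omega>. \<integral>y. ?s n y \<partial>(\<zeta> \<omega>)) \<in> borel_measurable M" for n
      by (rule measurable_compose[OF \<zeta>], rule integral_measurable_M1)
        (intro continuous_on_cts_step bounded_range_cts_step; simp)+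
    show "AE \<omega> in M. (\<lambda>n. \<integral>y. ?s n y \<partial>(\<zeta> \<omega>)) \<longlonglongrightarrow> cdf (\<zeta> \<omega>) x"
      by (intro AE_I2 cdf_eq_lim_cts_step random_measure_real_distribution[OF \<zeta>])
    show "AE \<omega> in M. norm (\<integral>y. ?s n y \<partial>(\<zeta> \<omega>)) \<le> 1" for n
      using bnd by (intro AE_I2) simp
  qed simp
qed

lemma stationary_expectation:
  fixes h :: "real measure \<Rightarrow> real"
  assumes "stationary_random_measures P \<xi>" "h \<in> borel_measurable M1"
  shows "(\<integral>\<omega>. h (\<xi> t \<omega>) \<partial>P) = (\<integral>\<omega>. h (\<xi> 0 \<omega>) \<partial>P)"
proof -
  let ?S = "PiM UNIV (\<lambda>_ :: nat. M1)"
  have \<xi>: "\<xi> t \<in> measurable P M1" for t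
    using assms(1) by (auto simp: stationary_random_measures_def)
  have eq: "distr P ?S (\<lambda>\<omega> s. \<xi> (s + t) \<omega>) = distr P ?S (\<lambda>\<omega> s. \<xi> s \<omega>)"
    using assms(1) by (auto simp: stationary_random_measures_def)
  have path: "(\<lambda>\<omega> s. \<xi> (s + r) \<omega>) \<in> measurable P ?S" for r
    by (rule measurable_PiM_single') (use \<xi> in \<open>auto simp: measurable_space[OF \<xi>]\<close>)
  have h: "(\<lambda>x. h (x 0)) \<in> borel_measurable ?S"
    by (rule measurable_compose[OF _ assms(2)]) simp
  have "(\<integral>\<omega>. h (\<xi> t \<omega>) \<partial>P) = integral\<^sup>L (distr P ?S (\<lambda>\<omega> s. \<xi> (s + t) \<omega>)) (\<lambda>x. h (x 0))"
    by (subst integral_distr[OF path h]) simp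
  also have "\<dots> = integral\<^sup>L (distr P ?S (\<lambda>\<omega> s. \<xi> (s + 0) \<omega>)) (\<lambda>x. h (x 0))"
    by (simp add: eq)
  also have "\<dots> = (\<integral>\<omega>. h (\<xi> 0 \<omega>) \<partial>P)"
    by (subst integral_distr[OF path h]) simp
  finally show ?thesis .
qed

section \<open>Square-integrable functions\<close>

lemma L2_measurable: "f \<in> L2 \<mu> \<Longrightarrow> f \<in> borel_measurable \<mu>"
  by (simp add: L2_def)

lemma L2_inner_integrable:
  assumes "f \<in> L2 \<mu>" "g \<in> L2 \<mu>"
  shows "integrable \<mu> (\<lambda>x. f x * g x)"
proof (rule Bochner_Integration.integrable_bound)
  show "integrable \<mu> (\<lambda>x. (f x)\<^sup>2 + (g x)\<^sup>2)"
    using assms by (simp add: L2_def)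
  show "(\<lambda>x. f x * g x) \<in> borel_measurable \<mu>"
    using assms by (auto simp: L2_def)
  have "\<bar>a * b\<bar> \<le> a\<^sup>2 + b\<^sup>2" for a b :: real
  proof -
    have "2 * \<bar>a * b\<bar> \<le> a\<^sup>2 + b\<^sup>2"
      using sum_squares_bound[of "\<bar>a\<bar>" "\<bar>b\<bar>"] by (simp add: abs_mult mult.assoc)
    then show ?thesis using abs_ge_zero[of "a * b"] by linarith
  qed
  then show "AE x in \<mu>. norm (f x * g x) \<le> norm ((f x)\<^sup>2 + (g x)\<^sup>2)"
    by simp
qed

lemma L2_add: "f \<in> L2 \<mu> \<Longrightarrow> g \<in> L2 \<mu> \<Longrightarrow> (\<lambda>x. f x + g x) \<in> L2 \<mu>"
  using L2_inner_integrable[of f \<mu> g] by (auto simp: L2_def power2_sum mult.assoc intro: borel_measurable_add)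

lemma L2_cmult: "f \<in> L2 \<mu> \<Longrightarrow> (\<lambda>x. c * f x) \<in> L2 \<mu>"
  by (auto simp: L2_def power_mult_distrib intro: borel_measurable_times)

lemma L2_diff: "f \<in> L2 \<mu> \<Longrightarrow> g \<in> L2 \<mu> \<Longrightarrow> (\<lambda>x. f x - g x) \<in> L2 \<mu>"
  using L2_inner_integrable[of f \<mu> g] by (auto simp: L2_def power2_diff mult.assoc intro: borel_measurable_diff)

lemma L2_sum: "(\<And>j. j \<in> J \<Longrightarrow> f j \<in> L2 \<mu>) \<Longrightarrow> (\<lambda>x. \<Sum>j\<in>J. f j x) \<in> L2 \<mu>"
proof (induction J rule: infinite_finite_induct)
  case (insert j J)
  then show ?case by (simp add: L2_add)
qed (simp_all add: L2_def)

lemma L2_sum_cmult: "(\<And>j. j \<in> J \<Longrightarrow> f j \<in> L2 \<mu>) \<Longrightarrow> (\<lambda>x. \<Sum>j\<in>J. a j * f j x) \<in> L2 \<mu>"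
  by (intro L2_sum L2_cmult)

lemma L2_inner_commute: "L2_inner \<mu> f g = L2_inner \<mu> g f"
  by (simp add: L2_inner_def mult.commute)

lemma L2_inner_nonneg: "0 \<le> L2_inner \<mu> f f"
  by (simp add: L2_inner_def)

lemma L2_inner_add_left:
  "f \<in> L2 \<mu> \<Longrightarrow> g \<in> L2 \<mu> \<Longrightarrow> h \<in> L2 \<mu> \<Longrightarrow>
    L2_inner \<mu> (\<lambda>x. f x + g x) h = L2_inner \<mu> f h + L2_inner \<mu> g h"
  by (simp add: L2_inner_def distrib_right L2_inner_integrable)

lemma L2_inner_diff_left:
  "f \<in> L2 \<mu> \<Longrightarrow> g \<in> L2 \<mu> \<Longrightarrow> h \<in> L2 \<mu> \<Longrightarrow>
    L2_inner \<mu> (\<lambda>x. f x - g x) h = L2_inner \<mu> f h - L2_inner \<mu> g h"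
  by (simp add: L2_inner_def left_diff_distrib L2_inner_integrable)

lemma L2_inner_cmult_left: "L2_inner \<mu> (\<lambda>x. c * f x) h = c * L2_inner \<mu> f h"
  by (simp add: L2_inner_def mult.assoc)

lemma L2_inner_diff_right:
  "f \<in> L2 \<mu> \<Longrightarrow> g \<in> L2 \<mu> \<Longrightarrow> h \<in> L2 \<mu> \<Longrightarrow>
    L2_inner \<mu> h (\<lambda>x. f x - g x) = L2_inner \<mu> h f - L2_inner \<mu> h g"
  using L2_inner_diff_left[of f \<mu> g h] by (simp add: L2_inner_commute)

lemma L2_inner_cmult_right: "L2_inner \<mu> h (\<lambda>x. c * f x) = c * L2_inner \<mu> h f"
  using L2_inner_cmult_left[of \<mu> c f h] by (simp add: L2_inner_commute)

lemma L2_inner_sum_left: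
  "(\<And>j. j \<in> J \<Longrightarrow> f j \<in> L2 \<mu>) \<Longrightarrow> h \<in> L2 \<mu> \<Longrightarrow>
    L2_inner \<mu> (\<lambda>x. \<Sum>j\<in>J. a j * f j x) h = (\<Sum>j\<in>J. a j * L2_inner \<mu> (f j) h)"
  by (simp add: L2_inner_def sum_distrib_right mult.assoc L2_inner_integrable)

lemma L2_inner_cong_AE:
  assumes "AE x in \<mu>. f x = f' x" "AE x in \<mu>. g x = g' x"
    and "f \<in> L2 \<mu>" "g \<in> L2 \<mu>" "f' \<in> L2 \<mu>" "g' \<in> L2 \<mu>"
  shows "L2_inner \<mu> f g = L2_inner \<mu> f' g'"
  unfolding L2_inner_def
proof (rule integral_cong_AE)
  show "AE x in \<mu>. f x * g x = f' x * g' x" using assms(1,2) by eventually_elim simp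
qed (use assms(3-) in \<open>auto intro!: borel_measurable_times dest: L2_measurable\<close>)

lemma L2_inner_eq_0_iff:
  assumes "f \<in> L2 \<mu>"
  shows "L2_inner \<mu> f f = 0 \<longleftrightarrow> (AE x in \<mu>. f x = 0)"
  unfolding L2_inner_def using assms
  by (subst integral_nonneg_eq_0_iff_AE) (auto intro: L2_inner_integrable)

text \<open>The algebra behind both Cauchy-Schwarz inequalities below, for the inner product and for
  the quadratic form of the covariance operator.\<close>

lemma discriminant_nonneg_form:
  fixes a b c :: real
  assumes quad: "\<And>s t. 0 \<le> s\<^sup>2 * a - 2 * s * t * b + t\<^sup>2 * c"
  shows "b\<^sup>2 \<le> a * c"
proof (cases "a = 0")
  case True
  have "b = 0"
  proof (rule ccontr)
    assume "b \<noteq> 0"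
    with quad[of "(c + 1) / (2 * b)" 1] True show False by simp
  qed
  then show ?thesis using True by simp
next
  case False
  then have "0 < a" using quad[of 1 0] by simp
  moreover have "0 \<le> a * (a * c - b\<^sup>2)"
    using quad[of b a] by (simp add: power2_eq_square algebra_simps)
  ultimately have "0 \<le> a * c - b\<^sup>2" by (simp add: zero_le_mult_iff)
  then show ?thesis by simp
qed

lemma L2_Cauchy_Schwarz:
  assumes "f \<in> L2 \<mu>" "g \<in> L2 \<mu>"
  shows "(L2_inner \<mu> f g)\<^sup>2 \<le> L2_inner \<mu> f f * L2_inner \<mu> g g"
proof -
  define a b c where "a = L2_inner \<mu> f f" and "b = L2_inner \<mu> f g" and "c = L2_inner \<mu> g g"
  have quad: "0 \<le> s\<^sup>2 * a - 2 * s * t * b + t\<^sup>2 * c" for s t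
  proof -
    have "0 \<le> L2_inner \<mu> (\<lambda>x. s * f x - t * g x) (\<lambda>x. s * f x - t * g x)"
      by (rule L2_inner_nonneg)
    also have "\<dots> = s\<^sup>2 * a - 2 * s * t * b + t\<^sup>2 * c"
      unfolding a_def b_def c_def
      using L2_cmult[OF assms(1), of s] L2_cmult[OF assms(2), of t]
      by (simp add: L2_inner_diff_left L2_inner_diff_right L2_diff L2_inner_cmult_left
          L2_inner_cmult_right L2_inner_commute[of \<mu> g f] assms power2_eq_square algebra_simps)
    finally show ?thesis .
  qed
  show ?thesis
    using discriminant_nonneg_form[OF quad] by (simp add: a_def b_def c_def)
qed

lemma L2_bounded:
  assumes "finite_measure M" and "f \<in> borel_measurable M" "\<And>x. x \<in> space M \<Longrightarrow> \<bar>f x\<bar> \<le> B"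
  shows "f \<in> L2 M"
  unfolding L2_def
proof (intro CollectI conjI)
  interpret finite_measure M by fact
  show "integrable M (\<lambda>x. (f x)\<^sup>2)"
    by (rule integrable_const_bound[of _ "B\<^sup>2"])
      (use assms in \<open>auto intro!: AE_I2 simp: abs_le_square_iff[symmetric] dest: order_trans[OF _ abs_ge_self]\<close>)
qed fact

lemma L2_integrable:
  assumes "finite_measure M" and "f \<in> L2 M"
  shows "integrable M f"
  using L2_inner_integrable[OF assms(2) L2_bounded[OF assms(1), of "\<lambda>_. 1" 1]] by simp

section \<open>Right-continuous functions on a grid\<close>

text \<open>The right end point of the half-open cell of length \<open>1 / (m + 1)\<close> that contains \<open>x\<close>. It lies
  strictly to the right of \<open>x\<close>, so values of a right-continuous function at the grid points
  converge to its value at \<open>x\<close>.\<close>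

definition grid :: "nat \<Rightarrow> real \<Rightarrow> real" where
  "grid m x = (real_of_int \<lfloor>real (Suc m) * x\<rfloor> + 1) / real (Suc m)"

lemma grid_gt: "x < grid m x"
  unfolding grid_def by (simp add: field_simps) linarith

lemma grid_le: "grid m x \<le> x + 1 / real (Suc m)"
proof -
  have "grid m x \<le> (real (Suc m) * x + 1) / real (Suc m)"
    unfolding grid_def by (intro divide_right_mono) auto
  then show ?thesis by (simp add: add_divide_distrib)
qed

lemma filterlim_grid: "filterlim (\<lambda>m. grid m x) (at_right x) sequentially"
proof -
  have "(\<lambda>m. grid m x) \<longlonglongrightarrow> x"
  proof (rule tendsto_sandwich[of "\<lambda>_. x" _ _ "\<lambda>m. x + 1 / real (Suc m)"])
    have "(\<lambda>n. x + 1 / real (Suc n)) \<longlonglongrightarrow> x + 0"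
      using LIMSEQ_inverse_real_of_nat by (intro tendsto_intros) (simp add: divide_inverse)
    then show "(\<lambda>n. x + 1 / real (Suc n)) \<longlonglongrightarrow> x" by simp
  qed (auto intro!: always_eventually grid_gt[THEN less_imp_le] grid_le simp del: of_nat_Suc)
  then show ?thesis by (auto simp: filterlim_at grid_gt intro!: always_eventually less_imp_neq[THEN not_sym])
qed

lemma tendsto_grid:
  "continuous (at_right x) f \<Longrightarrow> (\<lambda>m. f (grid m x)) \<longlonglongrightarrow> f x"
  unfolding continuous_within by (rule filterlim_compose[OF _ filterlim_grid])

text \<open>The process is the pointwise limit of its values at the grid points, where the second variable
  enters only through an integer.\<close>

lemma measurable_right_continuous:
  fixes F :: "'a \<Rightarrow> real \<Rightarrow> real"
  assumes [measurable]: "\<And>x. (\<lambda>\<omega>. F \<omega> x) \<in> borel_measurable M"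
    and "sets \<mu> = sets borel"
    and "\<And>\<omega> x. \<omega> \<in> space M \<Longrightarrow> continuous (at_right x) (F \<omega>)"
  shows "(\<lambda>(\<omega>, x). F \<omega> x) \<in> borel_measurable (M \<Otimes>\<^sub>M \<mu>)"
proof (rule borel_measurable_LIMSEQ_real)
  have [measurable_cong]: "sets \<mu> = sets borel" by fact
  show "(\<lambda>p. F (fst p) (grid m (snd p))) \<in> borel_measurable (M \<Otimes>\<^sub>M \<mu>)" for m
    unfolding grid_def
    by (rule measurable_compose_countable[where g = "\<lambda>p. \<lfloor>real (Suc m) * snd p\<rfloor>"
          and f = "\<lambda>k p. F (fst p) ((real_of_int k + 1) / real (Suc m))"]) measurable
  show "(\<lambda>m. F (fst p) (grid m (snd p))) \<longlonglongrightarrow> (\<lambda>(\<omega>, x). F \<omega> x) p" if "p \<in> space (M \<Otimes>\<^sub>M \<mu>)" for p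
    using that by (auto simp: space_pair_measure split_beta intro!: tendsto_grid assms(3))
qed

section \<open>The covariance operator of a random distribution function\<close>

text \<open>A random nondecreasing right-continuous function \<open>F\<close> with values in the unit interval, with mean
  \<open>G\<close> and covariance kernel \<open>C\<close>. Both \<open>G\<close> and \<open>C\<close> are parameters, so that all members of a
  stationary sequence can be treated with the same mean and the same kernel. The path
  properties are required only on the space of \<open>P\<close>.\<close>

locale random_cdf = prob_space P + mu: finite_measure \<mu>
  for P :: "'a measure" and \<mu> :: "real measure" +
  fixes F :: "'a \<Rightarrow> real \<Rightarrow> real" and G :: "real \<Rightarrow> real" and C :: "real \<Rightarrow> real \<Rightarrow> real"
  assumes sets_mu[measurable_cong]: "sets \<mu> = sets borel"
    and F_measurable[measurable]: "\<And>x. (\<lambda>\<omega>. F \<omega> x) \<in> borel_measurable P"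
    and F_mono: "\<And>\<omega>. \<omega> \<in> space P \<Longrightarrow> mono (F \<omega>)"
    and F_right_cont: "\<And>\<omega> x. \<omega> \<in> space P \<Longrightarrow> continuous (at_right x) (F \<omega>)"
    and F_nonneg: "\<And>\<omega> x. \<omega> \<in> space P \<Longrightarrow> 0 \<le> F \<omega> x"
    and F_le_1: "\<And>\<omega> x. \<omega> \<in> space P \<Longrightarrow> F \<omega> x \<le> 1"
    and mean: "\<And>x. expectation (\<lambda>\<omega>. F \<omega> x) = G x"
    and cov: "\<And>x y. C x y = expectation (\<lambda>\<omega>. (F \<omega> x - G x) * (F \<omega> y - G y))"
begin

sublocale pm: pair_sigma_finite P \<mu> ..

lemma mu_finite: "finite_measure \<mu>"
  by (rule mu.finite_measure_axioms)

lemma space_mu: "space \<mu> = UNIV"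
  using sets_eq_imp_space_eq[OF sets_mu] by simp

lemma F_integrable: "integrable P (\<lambda>\<omega>. F \<omega> x)"
  by (rule integrable_const_bound[of _ 1]) (auto simp: F_nonneg F_le_1)

text \<open>The expectation of \<open>F\<close> weighted by a bounded nonnegative variable is again a bounded
  right-continuous monotone function; the mean \<open>G\<close> and both parts of a function in the range of
  the covariance operator are of this form.\<close>

lemma weighted_mean:
  assumes W[measurable]: "W \<in> borel_measurable P"
    and W0: "\<And>\<omega>. \<omega> \<in> space P \<Longrightarrow> 0 \<le> W \<omega>" and WB: "\<And>\<omega>. \<omega> \<in> space P \<Longrightarrow> W \<omega> \<le> B"
  shows "integrable P (\<lambda>\<omega>. F \<omega> x * W \<omega>)"
    and "mono (\<lambda>x. expectation (\<lambda>\<omega>. F \<omega> x * W \<omega>))"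
    and "continuous (at_right x) (\<lambda>x. expectation (\<lambda>\<omega>. F \<omega> x * W \<omega>))"
    and "0 \<le> expectation (\<lambda>\<omega>. F \<omega> x * W \<omega>)" "expectation (\<lambda>\<omega>. F \<omega> x * W \<omega>) \<le> B"
proof -
  have bnd: "0 \<le> F \<omega> x * W \<omega> \<and> F \<omega> x * W \<omega> \<le> B" if "\<omega> \<in> space P" for \<omega> x
    using mult_mono[of "F \<omega> x" 1 "W \<omega>" B] that by (simp add: F_nonneg F_le_1 W0 WB)
  show int: "integrable P (\<lambda>\<omega>. F \<omega> x * W \<omega>)" for x
    by (rule integrable_const_bound[of _ B]) (use bnd in \<open>auto intro!: AE_I2\<close>)
  show "mono (\<lambda>x. expectation (\<lambda>\<omega>. F \<omega> x * W \<omega>))"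
    by (intro monoI integral_mono int mult_right_mono) (auto simp: W0 F_mono[THEN monoD])
  show "continuous (at_right x) (\<lambda>x. expectation (\<lambda>\<omega>. F \<omega> x * W \<omega>))"
    unfolding continuous_within
  proof (rule tendsto_at_right_sequentially[where b = "x + 1"])
    fix s :: "nat \<Rightarrow> real" assume s: "\<And>n. x < s n" "s \<longlonglongrightarrow> x"
    show "(\<lambda>n. expectation (\<lambda>\<omega>. F \<omega> (s n) * W \<omega>)) \<longlonglongrightarrow> expectation (\<lambda>\<omega>. F \<omega> x * W \<omega>)"
    proof (rule integral_dominated_convergence[where w = "\<lambda>_. B"])
      have "filterlim s (at_right x) sequentially"
        using s by (auto simp: filterlim_at intro!: always_eventually less_imp_neq[THEN not_sym])
      then have "(\<lambda>n. F \<omega> (s n)) \<longlonglongrightarrow> F \<omega> x" if "\<omega> \<in> space P" for \<omega>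
        using F_right_cont[OF that, of x] unfolding continuous_within
        by (rule filterlim_compose[rotated])
      then show "AE \<omega> in P. (\<lambda>n. F \<omega> (s n) * W \<omega>) \<longlonglongrightarrow> F \<omega> x * W \<omega>"
        by (intro AE_I2 tendsto_mult_right) auto
      show "AE \<omega> in P. norm (F \<omega> (s n) * W \<omega>) \<le> B" for n
        using bnd by (intro AE_I2) simp
    qed auto
  qed simp
  show "0 \<le> expectation (\<lambda>\<omega>. F \<omega> x * W \<omega>)"
    by (rule integral_nonneg_AE) (use bnd in \<open>auto intro!: AE_I2\<close>)
  have "expectation (\<lambda>\<omega>. F \<omega> x * W \<omega>) \<le> expectation (\<lambda>_. B)"
    by (rule integral_mono) (use bnd int in auto)
  then show "expectation (\<lambda>\<omega>. F \<omega> x * W \<omega>) \<le> B"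
    by (simp add: prob_space)
qed

lemma G_mono: "mono G" and G_right_cont: "continuous (at_right x) G"
  and G_nonneg: "0 \<le> G x" and G_le_1: "G x \<le> 1"
  using weighted_mean[of "\<lambda>_. 1" 1] by (simp_all add: mean)

lemma G_measurable[measurable]: "G \<in> borel_measurable borel"
  by (rule borel_measurable_mono[OF G_mono])

text \<open>The centred process.\<close>

definition X :: "'a \<Rightarrow> real \<Rightarrow> real" where
  "X \<omega> x = F \<omega> x - G x"

lemma X_abs_le_1: "\<omega> \<in> space P \<Longrightarrow> \<bar>X \<omega> x\<bar> \<le> 1"
  using F_nonneg[of \<omega> x] F_le_1[of \<omega> x] G_nonneg[of x] G_le_1[of x] by (auto simp: X_def)

lemma X_right_cont: "\<omega> \<in> space P \<Longrightarrow> continuous (at_right x) (X \<omega>)"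
  unfolding X_def[abs_def] by (intro continuous_intros F_right_cont G_right_cont)

lemma X_measurable1[measurable]: "(\<lambda>\<omega>. X \<omega> x) \<in> borel_measurable P"
  unfolding X_def by measurable

lemma X_measurable[measurable]: "(\<lambda>p. X (fst p) (snd p)) \<in> borel_measurable (P \<Otimes>\<^sub>M \<mu>)"
  using measurable_right_continuous[OF X_measurable1 sets_mu X_right_cont] by (simp add: split_beta')

lemma X_measurable_compose[measurable (raw)]:
  "g \<in> measurable N P \<Longrightarrow> h \<in> measurable N \<mu> \<Longrightarrow> (\<lambda>z. X (g z) (h z)) \<in> borel_measurable N"
  using measurable_compose[OF measurable_Pair X_measurable, of g N h] by simp

lemma X_measurable2: "\<omega> \<in> space P \<Longrightarrow> X \<omega> \<in> borel_measurable \<mu>"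
  using measurable_Pair2[OF X_measurable, of \<omega>] by simp

lemma X_L2: "\<omega> \<in> space P \<Longrightarrow> X \<omega> \<in> L2 \<mu>"
  by (rule L2_bounded[OF mu_finite X_measurable2 X_abs_le_1])

lemma cov_X: "C x y = expectation (\<lambda>\<omega>. X \<omega> x * X \<omega> y)"
  by (simp add: cov X_def)

text \<open>The coefficient of the centred process along a function.\<close>

definition coeff :: "(real \<Rightarrow> real) \<Rightarrow> 'a \<Rightarrow> real" where
  "coeff f \<omega> = L2_inner \<mu> (X \<omega>) f"

lemma coeff_measurable[measurable]:
  assumes "f \<in> L2 \<mu>" shows "coeff f \<in> borel_measurable P"
proof -
  have [measurable]: "f \<in> borel_measurable \<mu>" using assms by (rule L2_measurable)
  show ?thesis
    unfolding coeff_def L2_inner_def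
    by (rule mu.borel_measurable_lebesgue_integral) (simp add: split_beta')
qed

lemma coeff_bound:
  assumes f: "f \<in> L2 \<mu>" and \<omega>: "\<omega> \<in> space P"
  shows "\<bar>coeff f \<omega>\<bar> \<le> (\<integral>y. \<bar>f y\<bar> \<partial>\<mu>)"
proof -
  have "\<bar>coeff f \<omega>\<bar> \<le> (\<integral>y. \<bar>X \<omega> y * f y\<bar> \<partial>\<mu>)"
    unfolding coeff_def L2_inner_def by (rule integral_abs_bound)
  also have "\<dots> \<le> (\<integral>y. \<bar>f y\<bar> \<partial>\<mu>)"
    using X_abs_le_1[OF \<omega>]
    by (intro integral_mono integrable_abs L2_inner_integrable L2_integrable mu_finite X_L2 f \<omega>)
      (simp add: abs_mult mult_left_le_one_le)
  finally show ?thesis .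
qed

lemma coeff_mult_integrable:
  assumes "f \<in> L2 \<mu>" "g \<in> L2 \<mu>"
  shows "integrable P (\<lambda>\<omega>. coeff f \<omega> * coeff g \<omega>)"
proof (rule integrable_const_bound)
  show "AE \<omega> in P. norm (coeff f \<omega> * coeff g \<omega>) \<le> (\<integral>y. \<bar>f y\<bar> \<partial>\<mu>) * (\<integral>y. \<bar>g y\<bar> \<partial>\<mu>)"
    using coeff_bound[OF assms(1)] coeff_bound[OF assms(2)]
    by (intro AE_I2) (simp add: abs_mult mult_mono)
qed (use assms in measurable)

lemma coeff_integrable: "f \<in> L2 \<mu> \<Longrightarrow> integrable P (coeff f)"
  by (rule integrable_const_bound[of _ "\<integral>y. \<bar>f y\<bar> \<partial>\<mu>"]) (auto intro!: AE_I2 coeff_bound)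

text \<open>The use of Fubini's theorem behind all moments of the coefficients.\<close>

lemma expectation_mult_coeff:
  assumes W[measurable]: "W \<in> borel_measurable P" and WB: "\<And>\<omega>. \<omega> \<in> space P \<Longrightarrow> \<bar>W \<omega>\<bar> \<le> B"
    and f: "f \<in> L2 \<mu>"
  shows "expectation (\<lambda>\<omega>. W \<omega> * coeff f \<omega>) = (\<integral>y. expectation (\<lambda>\<omega>. W \<omega> * X \<omega> y) * f y \<partial>\<mu>)"
proof -
  have [measurable]: "f \<in> borel_measurable \<mu>" using f by (rule L2_measurable)
  let ?h = "\<lambda>p. W (fst p) * X (fst p) (snd p) * f (snd p)"
  have B0: "0 \<le> B" using WB not_empty by fastforce
  have bnd: "\<bar>W \<omega> * X \<omega> y\<bar> \<le> B" if "\<omega> \<in> space P" for \<omega> y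
    using mult_mono[of "\<bar>W \<omega>\<bar>" B "\<bar>X \<omega> y\<bar>" 1] WB[OF that] X_abs_le_1[OF that, of y] B0
    by (simp add: abs_mult)
  have dom: "integrable (P \<Otimes>\<^sub>M \<mu>) (\<lambda>p. B * \<bar>f (snd p)\<bar>)"
  proof (rule pm.Fubini_integrable)
    show "AE \<omega> in P. integrable \<mu> (\<lambda>y. B * \<bar>f (snd (\<omega>, y))\<bar>)"
      using L2_integrable[OF mu_finite f] by simp
  qed simp_all
  have int: "integrable (P \<Otimes>\<^sub>M \<mu>) ?h"
  proof (rule Bochner_Integration.integrable_bound[OF dom])
    show "AE p in P \<Otimes>\<^sub>M \<mu>. norm (?h p) \<le> norm (B * \<bar>f (snd p)\<bar>)"
      using bnd B0 by (intro AE_I2)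
        (auto simp: space_pair_measure abs_mult intro!: mult_right_mono)
  qed measurable
  have "expectation (\<lambda>\<omega>. W \<omega> * coeff f \<omega>) = expectation (\<lambda>\<omega>. \<integral>y. W \<omega> * X \<omega> y * f y \<partial>\<mu>)"
    by (simp add: coeff_def L2_inner_def mult.assoc)
  also have "\<dots> = (\<integral>y. expectation (\<lambda>\<omega>. W \<omega> * X \<omega> y * f y) \<partial>\<mu>)"
    by (rule pm.Fubini_integral[symmetric]) (use int in \<open>simp add: split_beta'\<close>)
  finally show ?thesis by simp
qed

lemma expectation_X: "expectation (\<lambda>\<omega>. X \<omega> x) = 0"
  unfolding X_def using F_integrable by (simp add: mean prob_space)

lemma expectation_coeff:
  assumes "f \<in> L2 \<mu>" shows "expectation (coeff f) = 0"
  using expectation_mult_coeff[of "\<lambda>_. 1" 1 f] assms by (simp add: expectation_X)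

text \<open>The covariance operator, defined pointwise: \<open>T f\<close> is a function on the whole line, not an
  equivalence class.\<close>

definition T :: "(real \<Rightarrow> real) \<Rightarrow> real \<Rightarrow> real" where
  "T f x = (\<integral>y. C x y * f y \<partial>\<mu>)"

lemma T_eq_expectation_X:
  assumes "f \<in> L2 \<mu>"
  shows "T f x = expectation (\<lambda>\<omega>. X \<omega> x * coeff f \<omega>)"
  unfolding T_def cov_X
  by (rule expectation_mult_coeff[symmetric, where B = 1])
    (use assms X_abs_le_1 in auto)

lemma C_section_L2: "C x \<in> L2 \<mu>"
proof (rule L2_bounded[OF mu_finite])
  have "(\<lambda>y. expectation (\<lambda>\<omega>. X \<omega> x * X \<omega> y)) \<in> borel_measurable \<mu>"
    by (rule borel_measurable_lebesgue_integral) measurable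
  then show "C x \<in> borel_measurable \<mu>" by (simp add: cov_X[abs_def])
  show "\<bar>C x y\<bar> \<le> 1" for y
  proof -
    have b: "\<bar>X \<omega> x * X \<omega> y\<bar> \<le> 1" if "\<omega> \<in> space P" for \<omega>
      using mult_mono[OF X_abs_le_1[OF that, of x] X_abs_le_1[OF that, of y]] by (simp add: abs_mult)
    have i: "integrable P (\<lambda>\<omega>. X \<omega> x * X \<omega> y)"
      by (rule integrable_const_bound[of _ 1]) (use b in auto)
    have "\<bar>C x y\<bar> \<le> expectation (\<lambda>\<omega>. \<bar>X \<omega> x * X \<omega> y\<bar>)"
      unfolding cov_X by (rule integral_abs_bound)
    also have "\<dots> \<le> expectation (\<lambda>_. 1)"
      by (rule integral_mono) (use b i in auto)
    finally show ?thesis by (simp add: prob_space)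
  qed
qed

lemma T_eq_inner: "T f x = L2_inner \<mu> (C x) f"
  by (simp add: T_def L2_inner_def)

text \<open>Splitting the coefficient into positive and negative part exhibits \<open>T f\<close> as a difference of
  two monotone right-continuous functions. The term with \<open>G\<close> drops out because the coefficient is
  centred.\<close>

lemma T_decomposition:
  assumes f: "f \<in> L2 \<mu>"
  shows "T f x = expectation (\<lambda>\<omega>. F \<omega> x * max (coeff f \<omega>) 0) - expectation (\<lambda>\<omega>. F \<omega> x * max (- coeff f \<omega>) 0)"
proof -
  have B: "\<bar>coeff f \<omega>\<bar> \<le> (\<integral>y. \<bar>f y\<bar> \<partial>\<mu>)" if "\<omega> \<in> space P" for \<omega>
    using coeff_bound[OF f that] .
  have [measurable]: "coeff f \<in> borel_measurable P" using f by simp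
  have i: "integrable P (\<lambda>\<omega>. F \<omega> x * max (coeff f \<omega>) 0)" "integrable P (\<lambda>\<omega>. F \<omega> x * max (- coeff f \<omega>) 0)"
    by (rule weighted_mean(1)[where B = "\<integral>y. \<bar>f y\<bar> \<partial>\<mu>"]; use B in force)+
  have e: "X \<omega> x * coeff f \<omega> = F \<omega> x * max (coeff f \<omega>) 0 - F \<omega> x * max (- coeff f \<omega>) 0 - G x * coeff f \<omega>" for \<omega>
    by (auto simp: X_def max_def algebra_simps)
  show ?thesis
    unfolding T_eq_expectation_X[OF f] e using i coeff_integrable[OF f]
    by (simp add: expectation_coeff[OF f, unfolded coeff_def[abs_def]] expectation_coeff[OF f])
qed

lemma T_bound:
  assumes "f \<in> L2 \<mu>" shows "\<bar>T f x\<bar> \<le> (\<integral>y. \<bar>f y\<bar> \<partial>\<mu>)"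
proof -
  have "\<bar>coeff f \<omega>\<bar> \<le> (\<integral>y. \<bar>f y\<bar> \<partial>\<mu>)" if "\<omega> \<in> space P" for \<omega>
    using coeff_bound[OF assms that] .
  then have b: "\<bar>X \<omega> x * coeff f \<omega>\<bar> \<le> (\<integral>y. \<bar>f y\<bar> \<partial>\<mu>)" if "\<omega> \<in> space P" for \<omega>
    using mult_mono[OF X_abs_le_1[OF that, of x]] that by (fastforce simp: abs_mult)
  have [measurable]: "coeff f \<in> borel_measurable P" using assms by simp
  have i: "integrable P (\<lambda>\<omega>. X \<omega> x * coeff f \<omega>)"
    by (rule integrable_const_bound[of _ "\<integral>y. \<bar>f y\<bar> \<partial>\<mu>"]) (use b in auto)
  have "\<bar>T f x\<bar> \<le> expectation (\<lambda>\<omega>. \<bar>X \<omega> x * coeff f \<omega>\<bar>)"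
    unfolding T_eq_expectation_X[OF assms] by (rule integral_abs_bound)
  also have "\<dots> \<le> expectation (\<lambda>_. \<integral>y. \<bar>f y\<bar> \<partial>\<mu>)"
    by (rule integral_mono) (use b i in auto)
  finally show ?thesis by (simp add: prob_space)
qed

lemma T_measurable:
  assumes f: "f \<in> L2 \<mu>" shows "T f \<in> borel_measurable borel"
proof -
  have B: "\<bar>coeff f \<omega>\<bar> \<le> (\<integral>y. \<bar>f y\<bar> \<partial>\<mu>)" if "\<omega> \<in> space P" for \<omega>
    using coeff_bound[OF f that] .
  have [measurable]: "coeff f \<in> borel_measurable P" using f by simp
  show ?thesis
    unfolding T_decomposition[OF f, abs_def]
    by (intro borel_measurable_diff borel_measurable_mono weighted_mean(2)[where B = "\<integral>y. \<bar>f y\<bar> \<partial>\<mu>"]; use B in force)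
qed

lemma T_L2: "f \<in> L2 \<mu> \<Longrightarrow> T f \<in> L2 \<mu>"
  by (rule L2_bounded[OF mu_finite _ T_bound]) (simp_all add: T_measurable measurable_cong_sets[OF sets_mu refl])

lemma T_inner:
  assumes "f \<in> L2 \<mu>" "g \<in> L2 \<mu>"
  shows "L2_inner \<mu> (T f) g = expectation (\<lambda>\<omega>. coeff f \<omega> * coeff g \<omega>)"
proof -
  have "expectation (\<lambda>\<omega>. coeff f \<omega> * coeff g \<omega>) = (\<integral>y. expectation (\<lambda>\<omega>. coeff f \<omega> * X \<omega> y) * g y \<partial>\<mu>)"
    by (rule expectation_mult_coeff[OF _ coeff_bound]) (use assms in auto)
  then show ?thesis
    by (simp add: L2_inner_def T_eq_expectation_X[OF assms(1)] mult.commute[of "coeff f _"])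
qed

lemma T_inner_nonneg: "f \<in> L2 \<mu> \<Longrightarrow> 0 \<le> L2_inner \<mu> (T f) f"
  by (simp add: T_inner)

lemma T_symmetric:
  "f \<in> L2 \<mu> \<Longrightarrow> g \<in> L2 \<mu> \<Longrightarrow> L2_inner \<mu> (T f) g = L2_inner \<mu> f (T g)"
  by (simp add: T_inner mult.commute L2_inner_commute[of \<mu> f])

lemma T_cong_AE:
  assumes "AE x in \<mu>. f x = g x" "f \<in> L2 \<mu>" "g \<in> L2 \<mu>"
  shows "T f = T g"
  unfolding T_eq_inner[abs_def] using assms by (intro ext L2_inner_cong_AE C_section_L2) auto

lemma T_cmult: "T (\<lambda>x. c * f x) x = c * T f x"
  by (simp add: T_eq_inner L2_inner_commute[of \<mu> "C x"] L2_inner_cmult_left)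

end

section \<open>Compactness and the quadratic form\<close>

context random_cdf begin

text \<open>Bounds the \<open>L\<^sup>1\<close> norm of the functions in the unit ball of \<open>L\<^sup>2(\<mu>)\<close>, since
  \<open>\<bar>a\<bar> \<le> a\<^sup>2 + 1\<close>.\<close>

abbreviation \<beta> :: real where "\<beta> \<equiv> 1 + measure \<mu> UNIV"

lemma integral_abs_le:
  assumes f: "f \<in> L2 \<mu>" and "L2_inner \<mu> f f \<le> 1"
  shows "(\<integral>y. \<bar>f y\<bar> \<partial>\<mu>) \<le> \<beta>"
proof -
  have le: "\<bar>a\<bar> \<le> a\<^sup>2 + 1" for a :: real
  proof -
    have "2 * \<bar>a\<bar> \<le> a\<^sup>2 + 1" using sum_squares_bound[of "\<bar>a\<bar>" 1] by simp
    then show ?thesis using abs_ge_zero[of a] by linarith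
  qed
  have "(\<integral>y. \<bar>f y\<bar> \<partial>\<mu>) \<le> (\<integral>y. (f y)\<^sup>2 + 1 \<partial>\<mu>)"
  proof (rule integral_mono)
    show "integrable \<mu> (\<lambda>y. \<bar>f y\<bar>)" using L2_integrable[OF mu_finite f] by simp
    show "integrable \<mu> (\<lambda>y. (f y)\<^sup>2 + 1)" using f by (simp add: L2_def)
  qed (rule le)
  also have "\<dots> = L2_inner \<mu> f f + measure \<mu> UNIV"
    using f by (simp add: L2_def L2_inner_def power2_eq_square space_mu)
  finally show ?thesis using assms(2) by simp
qed

text \<open>Compactness by Helly selection, applied to the two monotone parts one after the other.\<close>

lemma T_compact:
  assumes no_atoms: "\<And>A. countable A \<Longrightarrow> emeasure \<mu> A = 0"
    and f: "\<And>n. f n \<in> L2 \<mu>" and unit: "\<And>n. L2_inner \<mu> (f n) (f n) \<le> 1"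
  obtains s h where "strict_mono (s :: nat \<Rightarrow> nat)" "h \<in> L2 \<mu>"
    "AE x in \<mu>. (\<lambda>n. T (f (s n)) x) \<longlonglongrightarrow> h x"
proof -
  define U where "U n x = expectation (\<lambda>\<omega>. F \<omega> x * max (coeff (f n) \<omega>) 0)" for n x
  define V where "V n x = expectation (\<lambda>\<omega>. F \<omega> x * max (- coeff (f n) \<omega>) 0)" for n x
  have [measurable]: "coeff (f n) \<in> borel_measurable P" for n using f by simp
  have b: "\<bar>coeff (f n) \<omega>\<bar> \<le> \<beta>" if "\<omega> \<in> space P" for n \<omega>
    using coeff_bound[OF f that, of n] integral_abs_le[OF f unit, of n] by linarith
  have \<beta>: "0 \<le> \<beta>" by simp
  have U: "mono (U n)" "continuous (at_right x) (U n)" "\<bar>U n x\<bar> \<le> \<beta>" for n x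
  proof -
    have W: "(\<lambda>\<omega>. max (coeff (f n) \<omega>) 0) \<in> borel_measurable P"
      "\<And>\<omega>. \<omega> \<in> space P \<Longrightarrow> 0 \<le> max (coeff (f n) \<omega>) 0"
      "\<And>\<omega>. \<omega> \<in> space P \<Longrightarrow> max (coeff (f n) \<omega>) 0 \<le> \<beta>"
      using b[of _ n] \<beta> by (auto simp: abs_le_iff)
    show "mono (U n)" "continuous (at_right x) (U n)" "\<bar>U n x\<bar> \<le> \<beta>"
      using weighted_mean[OF W] unfolding U_def[abs_def] by auto
  qed
  have V: "mono (V n)" "continuous (at_right x) (V n)" "\<bar>V n x\<bar> \<le> \<beta>" for n x
  proof -
    have W: "(\<lambda>\<omega>. max (- coeff (f n) \<omega>) 0) \<in> borel_measurable P"
      "\<And>\<omega>. \<omega> \<in> space P \<Longrightarrow> 0 \<le> max (- coeff (f n) \<omega>) 0"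
      "\<And>\<omega>. \<omega> \<in> space P \<Longrightarrow> max (- coeff (f n) \<omega>) 0 \<le> \<beta>"
      using b[of _ n] \<beta> by (auto simp: abs_le_iff)
    show "mono (V n)" "continuous (at_right x) (V n)" "\<bar>V n x\<bar> \<le> \<beta>"
      using weighted_mean[OF W] unfolding V_def[abs_def] by auto
  qed
  obtain s1 U' where s1: "strict_mono (s1 :: nat \<Rightarrow> nat)" and U': "mono U'" "\<And>x. \<bar>U' x\<bar> \<le> \<beta>"
    and limU: "\<And>x. isCont U' x \<Longrightarrow> (\<lambda>n. U (s1 n) x) \<longlonglongrightarrow> U' x"
    using Helly_selection[of U \<beta>] U by blast
  obtain s2 V' where s2: "strict_mono (s2 :: nat \<Rightarrow> nat)" and V': "mono V'" "\<And>x. \<bar>V' x\<bar> \<le> \<beta>"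
    and limV: "\<And>x. isCont V' x \<Longrightarrow> (\<lambda>n. V (s1 (s2 n)) x) \<longlonglongrightarrow> V' x"
    using Helly_selection[of "\<lambda>n. V (s1 n)" \<beta>] V by blast
  let ?h = "\<lambda>x. U' x - V' x"
  show thesis
  proof (rule that)
    show "strict_mono (\<lambda>n. s1 (s2 n))"
      using strict_mono_o[OF s1 s2] by (simp add: o_def)
    show "?h \<in> L2 \<mu>"
    proof (rule L2_bounded[OF mu_finite])
      show "?h \<in> borel_measurable \<mu>"
        using borel_measurable_mono[OF U'(1)] borel_measurable_mono[OF V'(1)] by measurable
      show "\<bar>?h x\<bar> \<le> \<beta> + \<beta>" for x
        using U'(2)[of x] V'(2)[of x] by linarith
    qed
    have "countable {x. \<not> isCont U' x}" "countable {x. \<not> isCont V' x}"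
      by (intro mono_ctble_discont U' V')+
    then have c: "countable ({x. \<not> isCont U' x} \<union> {x. \<not> isCont V' x})" (is "countable ?N") by simp
    have lim: "(\<lambda>n. T (f (s1 (s2 n))) x) \<longlonglongrightarrow> ?h x" if "x \<notin> ?N" for x
    proof -
      have "(\<lambda>n. U (s1 (s2 n)) x) \<longlonglongrightarrow> U' x"
        using LIMSEQ_subseq_LIMSEQ[OF limU s2, of x] that by (simp add: o_def)
      moreover have "(\<lambda>n. V (s1 (s2 n)) x) \<longlonglongrightarrow> V' x" using limV that by simp
      ultimately show ?thesis
        unfolding T_decomposition[OF f] U_def V_def by (rule tendsto_diff)
    qed
    show "AE x in \<mu>. (\<lambda>n. T (f (s1 (s2 n))) x) \<longlonglongrightarrow> ?h x"
    proof (rule AE_I[where N = ?N])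
      show "?N \<in> sets \<mu>"
        unfolding sets_mu by (rule sets.countable[OF _ c]) simp
    qed (use lim no_atoms[OF c] in auto)
  qed
qed

lemma T_form_Cauchy_Schwarz:
  assumes f: "f \<in> L2 \<mu>" and g: "g \<in> L2 \<mu>"
  shows "(L2_inner \<mu> (T f) g)\<^sup>2 \<le> L2_inner \<mu> (T f) f * L2_inner \<mu> (T g) g"
proof (rule discriminant_nonneg_form)
  fix s t :: real
  have "0 \<le> expectation (\<lambda>\<omega>. (s * coeff f \<omega> - t * coeff g \<omega>)\<^sup>2)" by simp
  also have "\<dots> = expectation (\<lambda>\<omega>. s\<^sup>2 * (coeff f \<omega> * coeff f \<omega>) - 2 * s * t * (coeff f \<omega> * coeff g \<omega>)
      + t\<^sup>2 * (coeff g \<omega> * coeff g \<omega>))"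
    by (rule Bochner_Integration.integral_cong) (auto simp: power2_eq_square algebra_simps)
  also have "\<dots> = s\<^sup>2 * L2_inner \<mu> (T f) f - 2 * s * t * L2_inner \<mu> (T f) g + t\<^sup>2 * L2_inner \<mu> (T g) g"
    using assms by (simp add: T_inner coeff_mult_integrable)
  finally show "0 \<le> s\<^sup>2 * L2_inner \<mu> (T f) f - 2 * s * t * L2_inner \<mu> (T f) g + t\<^sup>2 * L2_inner \<mu> (T g) g" .
qed

lemma T_form_bound:
  assumes "f \<in> L2 \<mu>" "L2_inner \<mu> f f \<le> 1"
  shows "L2_inner \<mu> (T f) f \<le> \<beta>\<^sup>2"
proof -
  have "coeff f \<omega> * coeff f \<omega> \<le> \<beta>\<^sup>2" if "\<omega> \<in> space P" for \<omega>
  proof -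
    have "\<bar>coeff f \<omega>\<bar> \<le> \<beta>"
      using coeff_bound[OF assms(1) that] integral_abs_le[OF assms] by linarith
    then have "\<bar>coeff f \<omega>\<bar> * \<bar>coeff f \<omega>\<bar> \<le> \<beta> * \<beta>" by (intro mult_mono) auto
    then show ?thesis by (simp add: power2_eq_square)
  qed
  then have "expectation (\<lambda>\<omega>. coeff f \<omega> * coeff f \<omega>) \<le> expectation (\<lambda>_. \<beta>\<^sup>2)"
    by (intro integral_mono coeff_mult_integrable assms) auto
  then show ?thesis by (simp add: T_inner assms prob_space)
qed

end

section \<open>The Rayleigh bound for an eigensystem\<close>

text \<open>An orthonormal sequence of eigenfunctions, with eigenvalues in decreasing order, in which
  the eigenspace of each nonzero eigenvalue is exhausted. The
  kernel need not be exhausted. The measure \<open>\<mu>\<close> vanishes on countable sets.\<close>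

locale random_cdf_eigensystem = random_cdf P \<mu> F G C
  for P :: "'a measure" and \<mu> F G C +
  fixes lam :: "nat \<Rightarrow> real" and \<phi> :: "nat \<Rightarrow> real \<Rightarrow> real"
  assumes no_atoms: "\<And>A. countable A \<Longrightarrow> emeasure \<mu> A = 0"
    and lam_decseq: "decseq lam"
    and phi_L2: "\<And>j. \<phi> j \<in> L2 \<mu>"
    and phi_eigen: "\<And>j. AE x in \<mu>. T (\<phi> j) x = lam j * \<phi> j x"
    and phi_orthonormal: "\<And>i j. L2_inner \<mu> (\<phi> i) (\<phi> j) = (if i = j then 1 else 0)"
    and eigen_span: "\<And>c f. c \<noteq> 0 \<Longrightarrow> f \<in> L2 \<mu> \<Longrightarrow> (AE x in \<mu>. T f x = c * f x) \<Longrightarrow>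
        \<exists>J a. finite J \<and> J \<subseteq> {j. lam j = c} \<and> (AE x in \<mu>. f x = (\<Sum>j\<in>J. a j * \<phi> j x))"
begin

lemma T_phi_inner: "g \<in> L2 \<mu> \<Longrightarrow> L2_inner \<mu> (T (\<phi> j)) g = lam j * L2_inner \<mu> (\<phi> j) g"
proof -
  assume g: "g \<in> L2 \<mu>"
  have "L2_inner \<mu> (T (\<phi> j)) g = L2_inner \<mu> (\<lambda>x. lam j * \<phi> j x) g"
    by (rule L2_inner_cong_AE) (use phi_eigen g in \<open>auto intro: T_L2 phi_L2 L2_cmult\<close>)
  then show ?thesis by (simp add: L2_inner_cmult_left)
qed

lemma coeff_phi_covariance:
  "expectation (\<lambda>\<omega>. coeff (\<phi> i) \<omega> * coeff (\<phi> j) \<omega>) = (if i = j then lam j else 0)"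
  using T_phi_inner[OF phi_L2, of i j] by (simp add: T_inner phi_L2 phi_orthonormal)

lemma lam_nonneg: "0 \<le> lam j"
  using T_inner_nonneg[OF phi_L2, of j] by (simp add: T_phi_inner phi_L2 phi_orthonormal)

text \<open>The orthogonal complement of the first \<open>n\<close> eigenfunctions.\<close>

definition orth :: "nat \<Rightarrow> (real \<Rightarrow> real) set" where
  "orth n = {f \<in> L2 \<mu>. \<forall>i<n. L2_inner \<mu> f (\<phi> i) = 0}"

lemma orth_cmult: "f \<in> orth n \<Longrightarrow> (\<lambda>x. c * f x) \<in> orth n"
  by (simp add: orth_def L2_cmult L2_inner_cmult_left)

lemma orth_T: "f \<in> orth n \<Longrightarrow> T f \<in> orth n"
  using T_phi_inner[of f]
  by (simp add: orth_def T_L2 T_symmetric phi_L2 L2_inner_commute[of \<mu> f])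

text \<open>A bound for the quadratic form on the unit ball scales to all functions; the null functions
  need the Cauchy-Schwarz inequality because they cannot be normalised.\<close>

lemma T_form_normalise:
  assumes f: "f \<in> L2 \<mu>"
    and m: "\<And>c. L2_inner \<mu> (\<lambda>x. c * f x) (\<lambda>x. c * f x) \<le> 1 \<Longrightarrow>
      L2_inner \<mu> (T (\<lambda>x. c * f x)) (\<lambda>x. c * f x) \<le> m"
  shows "L2_inner \<mu> (T f) f \<le> m * L2_inner \<mu> f f"
proof (cases "L2_inner \<mu> f f = 0")
  case True
  then have "(L2_inner \<mu> (T f) f)\<^sup>2 \<le> 0"
    using L2_Cauchy_Schwarz[OF T_L2[OF f] f] by simp
  then show ?thesis using True by simp
next
  case False
  define d where "d = L2_inner \<mu> f f"
  define c where "c = 1 / sqrt d"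
  have d: "0 < d" using False L2_inner_nonneg[of \<mu> f] by (simp add: d_def)
  have c2: "c * c = 1 / d" using d by (simp add: c_def)
  have "L2_inner \<mu> (\<lambda>x. c * f x) (\<lambda>x. c * f x) = 1"
    using c2 d by (simp add: L2_inner_cmult_left L2_inner_cmult_right mult.assoc[symmetric] d_def[symmetric])
  then have "L2_inner \<mu> (T (\<lambda>x. c * f x)) (\<lambda>x. c * f x) \<le> m" by (intro m) simp
  moreover have "T (\<lambda>x. c * f x) = (\<lambda>x. c * T f x)" by (rule ext) (rule T_cmult)
  ultimately have "c * c * L2_inner \<mu> (T f) f \<le> m"
    by (simp add: L2_inner_cmult_left L2_inner_cmult_right mult.assoc)
  then show ?thesis using d by (simp add: c2 field_simps d_def)
qed

text \<open>The quadratic form of \<open>T\<close> on the complement of the first \<open>n\<close> eigenfunctions is bounded by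
  \<open>lam n\<close>. If its supremum \<open>m\<close> on the unit ball were larger, a maximising sequence \<open>f k\<close> would
  satisfy \<open>m * f k - T (f k) \<longlonglongrightarrow> 0\<close>; by compactness \<open>T (f k)\<close> has a limit \<open>h\<close> along a subsequence,
  and \<open>h\<close> is an eigenfunction for \<open>m\<close> orthogonal to the first \<open>n\<close> eigenfunctions. But the
  eigenspace of \<open>m > lam n\<close> is spanned by some of these.\<close>

theorem Rayleigh_bound:
  assumes f: "f \<in> orth n"
  shows "L2_inner \<mu> (T f) f \<le> lam n * L2_inner \<mu> f f"
proof -
  define S where "S = {L2_inner \<mu> (T f) f | f. f \<in> orth n \<and> L2_inner \<mu> f f \<le> 1}"
  define m where "m = Sup S"
  have bdd: "bdd_above S"
    by (rule bdd_aboveI[of _ "\<beta>\<^sup>2"]) (auto simp: S_def orth_def T_form_bound)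
  have ne: "S \<noteq> {}"
  proof -
    have "(\<lambda>_. 0) \<in> orth n" by (simp add: orth_def L2_def L2_inner_def)
    moreover have "L2_inner \<mu> (\<lambda>_. 0) (\<lambda>_. 0) \<le> 1" by (simp add: L2_inner_def)
    ultimately show ?thesis unfolding S_def by blast
  qed
  have form_le: "L2_inner \<mu> (T f) f \<le> m * L2_inner \<mu> f f" if "f \<in> orth n" for f
  proof (rule T_form_normalise)
    show "f \<in> L2 \<mu>" using that by (simp add: orth_def)
    show "L2_inner \<mu> (T (\<lambda>x. c * f x)) (\<lambda>x. c * f x) \<le> m"
      if "L2_inner \<mu> (\<lambda>x. c * f x) (\<lambda>x. c * f x) \<le> 1" for c
      unfolding m_def
      by (rule cSup_upper[OF _ bdd]) (use that orth_cmult[OF \<open>f \<in> orth n\<close>, of c] in \<open>auto simp: S_def\<close>)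
  qed
  have "m \<le> lam n"
  proof (rule ccontr)
    assume "\<not> m \<le> lam n"
    then have lt: "lam n < m" by simp
    then have m0: "0 < m" using lam_nonneg[of n] by linarith
    have "\<exists>f. f \<in> orth n \<and> L2_inner \<mu> f f \<le> 1 \<and> m - 1 / real (Suc k) < L2_inner \<mu> (T f) f" for k
      using less_cSupE[OF _ ne, of "m - 1 / real (Suc k)"] unfolding m_def[symmetric]
      by (auto simp: S_def)
    then obtain f where fo: "\<And>k. f k \<in> orth n" and f1: "\<And>k. L2_inner \<mu> (f k) (f k) \<le> 1"
      and fm: "\<And>k. m - 1 / real (Suc k) < L2_inner \<mu> (T (f k)) (f k)"
      by metis
    have f: "f k \<in> L2 \<mu>" for k using fo[of k] by (simp add: orth_def)
    define a where "a k = L2_inner \<mu> (T (f k)) (f k)" for k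
    have a_le: "a k \<le> m" for k
    proof -
      have "m * L2_inner \<mu> (f k) (f k) \<le> m * 1" using f1[of k] m0 by (intro mult_left_mono) auto
      then show ?thesis using form_le[OF fo, of k] unfolding a_def by linarith
    qed
    have a_lim: "a \<longlonglongrightarrow> m"
    proof (rule tendsto_sandwich[of "\<lambda>k. m - 1 / real (Suc k)" _ _ "\<lambda>_. m"])
      have "(\<lambda>k. m - 1 / real (Suc k)) \<longlonglongrightarrow> m - 0"
        using LIMSEQ_inverse_real_of_nat by (intro tendsto_intros) (simp add: divide_inverse)
      then show "(\<lambda>k. m - 1 / real (Suc k)) \<longlonglongrightarrow> m" by simp
    qed (use fm a_le in \<open>auto intro!: always_eventually less_imp_le simp: a_def simp del: of_nat_Suc\<close>)
    \<comment> \<open>The Cauchy-Schwarz inequality for the form of \<open>T\<close> improves the trivial bound on the norm of \<open>T (f k)\<close>.\<close>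
    define b where "b k = L2_inner \<mu> (T (f k)) (T (f k))" for k
    have b_le: "b k \<le> m * a k" for k
    proof (cases "b k = 0")
      case True
      then show ?thesis using m0 T_inner_nonneg[OF f, of k] by (simp add: a_def)
    next
      case False
      then have b0: "0 < b k" using L2_inner_nonneg[of \<mu> "T (f k)"] by (simp add: b_def)
      have "b k * b k \<le> a k * L2_inner \<mu> (T (T (f k))) (T (f k))"
        using T_form_Cauchy_Schwarz[OF f T_L2[OF f], of k k] by (simp add: a_def b_def power2_eq_square)
      also have "\<dots> \<le> a k * (m * b k)"
        using form_le[OF orth_T[OF fo], of k] T_inner_nonneg[OF f, of k]
        by (intro mult_left_mono) (simp_all add: a_def b_def)
      finally have "b k * b k \<le> (m * a k) * b k" by (simp add: mult_ac)
      then show ?thesis using b0 by simp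
    qed
    define r where "r k x = m * f k x - T (f k) x" for k x
    have rL2: "r k \<in> L2 \<mu>" for k
      unfolding r_def[abs_def] by (intro L2_diff L2_cmult f T_L2)
    have r_le: "L2_inner \<mu> (r k) (r k) \<le> m * (m - a k)" for k
    proof -
      have "L2_inner \<mu> (r k) (r k) = m * m * L2_inner \<mu> (f k) (f k) - 2 * m * a k + b k"
        using L2_cmult[OF f, of m k] T_L2[OF f, of k] rL2[of k] f[of k]
        unfolding r_def[abs_def]
        by (simp add: L2_inner_diff_left L2_inner_diff_right L2_inner_cmult_left L2_inner_cmult_right
            L2_inner_commute[of \<mu> "f k" "T (f k)"] a_def b_def algebra_simps)
      also have "\<dots> \<le> m * m * 1 - 2 * m * a k + m * a k"
        using f1[of k] m0 b_le[of k] by (intro add_mono diff_mono mult_left_mono) auto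
      finally show ?thesis by (simp add: algebra_simps)
    qed
    have r_lim: "(\<lambda>k. L2_inner \<mu> (r k) g) \<longlonglongrightarrow> 0" if g: "g \<in> L2 \<mu>" for g
    proof -
      have "(\<lambda>k. (L2_inner \<mu> (r k) g)\<^sup>2) \<longlonglongrightarrow> 0"
      proof (rule tendsto_sandwich[of "\<lambda>_. 0" _ _ "\<lambda>k. m * (m - a k) * L2_inner \<mu> g g"])
        have "(\<lambda>k. m * (m - a k) * L2_inner \<mu> g g) \<longlonglongrightarrow> m * (m - m) * L2_inner \<mu> g g"
          by (intro tendsto_intros a_lim)
        then show "(\<lambda>k. m * (m - a k) * L2_inner \<mu> g g) \<longlonglongrightarrow> 0" by simp
        have "(L2_inner \<mu> (r k) g)\<^sup>2 \<le> m * (m - a k) * L2_inner \<mu> g g" for k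
          using L2_Cauchy_Schwarz[OF rL2[of k] g] mult_right_mono[OF r_le[of k] L2_inner_nonneg[of \<mu> g]]
          by linarith
        then show "\<forall>\<^sub>F k in sequentially. (L2_inner \<mu> (r k) g)\<^sup>2 \<le> m * (m - a k) * L2_inner \<mu> g g"
          by (intro always_eventually allI)
      qed simp_all
      then have "(\<lambda>k. sqrt ((L2_inner \<mu> (r k) g)\<^sup>2)) \<longlonglongrightarrow> sqrt 0"
        by (rule tendsto_real_sqrt)
      then have "(\<lambda>k. \<bar>L2_inner \<mu> (r k) g\<bar>) \<longlonglongrightarrow> 0"
        unfolding real_sqrt_abs real_sqrt_zero .
      then show ?thesis by (rule tendsto_rabs_zero_cancel)
    qed
    obtain s h where s: "strict_mono (s :: nat \<Rightarrow> nat)" and h: "h \<in> L2 \<mu>"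
      and lim: "AE x in \<mu>. (\<lambda>k. T (f (s k)) x) \<longlonglongrightarrow> h x"
      by (rule T_compact[of f]) (assumption | rule no_atoms f f1)+
    have T_le: "\<bar>T (f k) x\<bar> \<le> \<beta>" for k x
      using T_bound[OF f, of k x] integral_abs_le[OF f f1, of k] by linarith
    have T_lim: "(\<lambda>k. L2_inner \<mu> (T (f (s k))) g) \<longlonglongrightarrow> L2_inner \<mu> h g" if g: "g \<in> L2 \<mu>" for g
      unfolding L2_inner_def
    proof (rule integral_dominated_convergence[where w = "\<lambda>x. \<beta> * \<bar>g x\<bar>"])
      show "AE x in \<mu>. (\<lambda>k. T (f (s k)) x * g x) \<longlonglongrightarrow> h x * g x"
        using lim by eventually_elim (rule tendsto_mult_right)
      show "AE x in \<mu>. norm (T (f (s k)) x * g x) \<le> \<beta> * \<bar>g x\<bar>" for k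
        using T_le by (intro AE_I2) (auto simp: abs_mult intro!: mult_right_mono)
    qed (use L2_integrable[OF mu_finite g] h g T_L2[OF f] in \<open>auto intro!: borel_measurable_times dest: L2_measurable\<close>)
    have f_lim: "(\<lambda>k. m * L2_inner \<mu> (f (s k)) g) \<longlonglongrightarrow> L2_inner \<mu> h g" if g: "g \<in> L2 \<mu>" for g
    proof -
      have "(\<lambda>k. L2_inner \<mu> (r (s k)) g + L2_inner \<mu> (T (f (s k))) g) \<longlonglongrightarrow> 0 + L2_inner \<mu> h g"
        using LIMSEQ_subseq_LIMSEQ[OF r_lim[OF g] s] T_lim[OF g] by (intro tendsto_add) (simp_all add: o_def)
      moreover have "L2_inner \<mu> (r (s k)) g + L2_inner \<mu> (T (f (s k))) g = m * L2_inner \<mu> (f (s k)) g" for k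
        unfolding r_def[abs_def] using g f T_L2[OF f]
        by (simp add: L2_inner_diff_left L2_cmult L2_inner_cmult_left)
      ultimately show ?thesis by simp
    qed
    \<comment> \<open>Weak convergence of \<open>m * f k\<close>, tested against the kernel sections, identifies \<open>T h\<close> pointwise.\<close>
    have h_eigen: "AE x in \<mu>. T h x = m * h x"
      using lim
    proof eventually_elim
      case (elim x)
      have "(\<lambda>k. m * T (f (s k)) x) \<longlonglongrightarrow> T h x"
        using f_lim[OF C_section_L2[of x]] by (simp add: T_eq_inner L2_inner_commute[of \<mu> "C x"])
      moreover have "(\<lambda>k. m * T (f (s k)) x) \<longlonglongrightarrow> m * h x"
        using elim by (rule tendsto_mult_left)
      ultimately show ?case by (rule LIMSEQ_unique)
    qed
    have h_orth: "L2_inner \<mu> h (\<phi> i) = 0" if "i < n" for i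
      using f_lim[OF phi_L2, of i] fo that by (simp add: orth_def LIMSEQ_const_iff)
    have "m * m \<le> L2_inner \<mu> h h"
    proof (rule LIMSEQ_le)
      show "(\<lambda>k. a (s k) * a (s k)) \<longlonglongrightarrow> m * m"
        using LIMSEQ_subseq_LIMSEQ[OF a_lim s] by (intro tendsto_mult) (simp_all add: o_def)
      have "(\<lambda>k. L2_inner \<mu> (T (f (s k))) (T (f (s k)))) \<longlonglongrightarrow> L2_inner \<mu> h h"
        unfolding L2_inner_def
      proof (rule integral_dominated_convergence[where w = "\<lambda>x. \<beta> * \<beta>"])
        show "AE x in \<mu>. (\<lambda>k. T (f (s k)) x * T (f (s k)) x) \<longlonglongrightarrow> h x * h x"
          using lim by eventually_elim (rule tendsto_mult)
        show "AE x in \<mu>. norm (T (f (s k)) x * T (f (s k)) x) \<le> \<beta> * \<beta>" for k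
          using T_le[of "s k"] by (intro AE_I2) (simp only: real_norm_def abs_mult, intro mult_mono, auto)
      qed (use h T_L2[OF f] in \<open>auto intro!: borel_measurable_times dest: L2_measurable\<close>)
      then show "(\<lambda>k. b (s k)) \<longlonglongrightarrow> L2_inner \<mu> h h" by (simp add: b_def)
      have "a k * a k \<le> b k" for k
      proof -
        have "a k * a k \<le> b k * L2_inner \<mu> (f k) (f k)"
          using L2_Cauchy_Schwarz[OF T_L2[OF f] f, of k k] by (simp add: a_def b_def power2_eq_square)
        also have "\<dots> \<le> b k * 1"
          using f1[of k] by (intro mult_left_mono) (simp_all add: b_def L2_inner_nonneg)
        finally show ?thesis by simp
      qed
      then show "\<exists>N. \<forall>k\<ge>N. a (s k) * a (s k) \<le> b (s k)" by blast
    qed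
    obtain J c where J: "finite J" "J \<subseteq> {j. lam j = m}" and hJ: "AE x in \<mu>. h x = (\<Sum>j\<in>J. c j * \<phi> j x)"
      using eigen_span[OF _ h h_eigen] m0 by auto
    have J_less: "j < n" if "j \<in> J" for j
    proof (rule ccontr)
      assume "\<not> j < n"
      then have "lam j \<le> lam n" using lam_decseq by (simp add: decseq_def)
      then show False using J(2) that lt by auto
    qed
    have "L2_inner \<mu> h h = L2_inner \<mu> (\<lambda>x. \<Sum>j\<in>J. c j * \<phi> j x) h"
      by (rule L2_inner_cong_AE) (use hJ h in \<open>auto intro: L2_sum_cmult phi_L2\<close>)
    also have "\<dots> = 0"
    proof -
      have "L2_inner \<mu> (\<phi> j) h = 0" if "j \<in> J" for j
        using h_orth[OF J_less[OF that]] L2_inner_commute[of \<mu> "\<phi> j" h] by simp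
      then show ?thesis using h by (simp add: L2_inner_sum_left phi_L2)
    qed
    finally show False
      using \<open>m * m \<le> L2_inner \<mu> h h\<close> mult_pos_pos[OF m0 m0] by linarith
  qed
  then have "m * L2_inner \<mu> f f \<le> lam n * L2_inner \<mu> f f"
    by (intro mult_right_mono L2_inner_nonneg)
  with form_le[OF f] show ?thesis by linarith
qed

end

section \<open>Almost sure convergence of the expansion\<close>

context random_cdf_eigensystem begin

text \<open>The residual of \<open>g\<close> after projection onto the first \<open>n\<close> eigenfunctions.\<close>

definition resid :: "nat \<Rightarrow> (real \<Rightarrow> real) \<Rightarrow> real \<Rightarrow> real" where
  "resid n g x = g x - (\<Sum>j<n. L2_inner \<mu> g (\<phi> j) * \<phi> j x)"

lemma resid_L2: "g \<in> L2 \<mu> \<Longrightarrow> resid n g \<in> L2 \<mu>"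
  unfolding resid_def[abs_def] by (intro L2_diff L2_sum_cmult phi_L2)

lemma resid_inner:
  assumes g: "g \<in> L2 \<mu>" and h: "h \<in> L2 \<mu>"
  shows "L2_inner \<mu> (resid n g) h = L2_inner \<mu> g h - (\<Sum>j<n. L2_inner \<mu> g (\<phi> j) * L2_inner \<mu> (\<phi> j) h)"
proof -
  have "(\<lambda>x. \<Sum>j<n. L2_inner \<mu> g (\<phi> j) * \<phi> j x) \<in> L2 \<mu>"
    by (intro L2_sum_cmult phi_L2)
  then show ?thesis
    unfolding resid_def[abs_def] using assms
    by (simp add: L2_inner_diff_left L2_inner_sum_left phi_L2)
qed

lemma resid_orth:
  assumes g: "g \<in> L2 \<mu>" shows "resid n g \<in> orth n"
proof -
  have "(\<Sum>j<n. L2_inner \<mu> g (\<phi> j) * L2_inner \<mu> (\<phi> j) (\<phi> i)) = L2_inner \<mu> g (\<phi> i)" if "i < n" for i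
  proof -
    have "(\<Sum>j<n. L2_inner \<mu> g (\<phi> j) * L2_inner \<mu> (\<phi> j) (\<phi> i))
        = (\<Sum>j<n. if j = i then L2_inner \<mu> g (\<phi> j) else 0)"
      by (rule sum.cong) (simp_all add: phi_orthonormal)
    then show ?thesis using that by simp
  qed
  then show ?thesis by (simp add: orth_def resid_L2 resid_inner phi_L2 g)
qed

lemma resid_inner_commute:
  assumes g: "g \<in> L2 \<mu>" and h: "h \<in> L2 \<mu>"
  shows "L2_inner \<mu> (resid n g) h = L2_inner \<mu> g (resid n h)"
  unfolding L2_inner_commute[of \<mu> g "resid n h"] resid_inner[OF g h] resid_inner[OF h g]
    L2_inner_commute[of \<mu> h g] L2_inner_commute[of \<mu> h "\<phi> _"] L2_inner_commute[of \<mu> g "\<phi> _"]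
  by (simp add: mult.commute)

lemma resid_norm:
  assumes g: "g \<in> L2 \<mu>"
  shows "L2_inner \<mu> (resid n g) (resid n g) = L2_inner \<mu> g g - (\<Sum>j<n. (L2_inner \<mu> g (\<phi> j))\<^sup>2)"
    and "L2_inner \<mu> (resid n g) (resid n g) = L2_inner \<mu> (resid n g) g"
proof -
  have o: "L2_inner \<mu> (\<phi> j) (resid n g) = 0" if "j < n" for j
    using resid_orth[OF g, of n] that by (simp add: orth_def L2_inner_commute[of \<mu> "\<phi> j"])
  have 1: "L2_inner \<mu> (resid n g) (resid n g) = L2_inner \<mu> g (resid n g)"
    using o by (simp add: resid_inner[OF g resid_L2[OF g]])
  then show 2: "L2_inner \<mu> (resid n g) (resid n g) = L2_inner \<mu> (resid n g) g"
    by (metis L2_inner_commute)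
  show "L2_inner \<mu> (resid n g) (resid n g) = L2_inner \<mu> g g - (\<Sum>j<n. (L2_inner \<mu> g (\<phi> j))\<^sup>2)"
    unfolding 2 resid_inner[OF g g] power2_eq_square
    by (simp add: L2_inner_commute[of \<mu> "\<phi> _" g])
qed

text \<open>The squared norm of the residual of the random function \<open>X\<close>, written in the form that makes
  its monotonicity in \<open>n\<close> and its measurability evident.\<close>

definition defect :: "nat \<Rightarrow> 'a \<Rightarrow> real" where
  "defect n \<omega> = L2_inner \<mu> (X \<omega>) (X \<omega>) - (\<Sum>j<n. (coeff (\<phi> j) \<omega>)\<^sup>2)"

lemma defect_eq_resid:
  "\<omega> \<in> space P \<Longrightarrow> defect n \<omega> = L2_inner \<mu> (resid n (X \<omega>)) (resid n (X \<omega>))"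
  using resid_norm(1)[OF X_L2] by (simp add: defect_def coeff_def)

lemma defect_nonneg: "\<omega> \<in> space P \<Longrightarrow> 0 \<le> defect n \<omega>"
  by (simp add: defect_eq_resid L2_inner_nonneg)

lemma norm_X_le: "\<omega> \<in> space P \<Longrightarrow> L2_inner \<mu> (X \<omega>) (X \<omega>) \<le> measure \<mu> UNIV"
proof -
  assume \<omega>: "\<omega> \<in> space P"
  have "L2_inner \<mu> (X \<omega>) (X \<omega>) \<le> (\<integral>x. 1 \<partial>\<mu>)"
    unfolding L2_inner_def
  proof (rule integral_mono)
    show "X \<omega> x * X \<omega> x \<le> 1" for x
      using mult_mono[OF X_abs_le_1[OF \<omega>, of x] X_abs_le_1[OF \<omega>, of x]] by (simp flip: abs_mult)
  qed (use L2_inner_integrable[OF X_L2 X_L2, OF \<omega> \<omega>] in simp_all)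
  then show ?thesis by (simp add: space_mu)
qed

lemma defect_le: "\<omega> \<in> space P \<Longrightarrow> defect n \<omega> \<le> measure \<mu> UNIV"
  using norm_X_le[of \<omega>] sum_nonneg[of "{..<n}" "\<lambda>j. (coeff (\<phi> j) \<omega>)\<^sup>2"]
  by (simp add: defect_def)

lemma defect_decseq: "decseq (\<lambda>n. defect n \<omega>)"
  by (rule decseq_SucI) (simp add: defect_def)

lemma norm_X_measurable[measurable]: "(\<lambda>\<omega>. L2_inner \<mu> (X \<omega>) (X \<omega>)) \<in> borel_measurable P"
  unfolding L2_inner_def
  by (rule mu.borel_measurable_lebesgue_integral) (simp add: split_beta')

lemma defect_measurable[measurable]: "defect n \<in> borel_measurable P"
proof -
  have [measurable]: "coeff (\<phi> j) \<in> borel_measurable P" for j by (rule coeff_measurable[OF phi_L2])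
  show ?thesis unfolding defect_def[abs_def] by measurable
qed

lemma defect_integrable: "integrable P (defect n)"
  by (rule integrable_const_bound[of _ "measure \<mu> UNIV"])
    (auto simp: defect_nonneg defect_le)

text \<open>By Bessel's inequality in expectation the eigenvalues are summable.\<close>

lemma lam_lim: "lam \<longlonglongrightarrow> 0"
proof (rule summable_LIMSEQ_zero, rule summableI_nonneg_bounded)
  show "0 \<le> lam j" for j by (rule lam_nonneg)
  fix n
  have "(\<Sum>j<n. lam j) = expectation (\<lambda>\<omega>. \<Sum>j<n. coeff (\<phi> j) \<omega> * coeff (\<phi> j) \<omega>)"
    using coeff_phi_covariance by (simp add: coeff_mult_integrable phi_L2)
  also have "\<dots> \<le> expectation (\<lambda>_. measure \<mu> UNIV)"
  proof (rule integral_mono)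
    show "(\<Sum>j<n. coeff (\<phi> j) \<omega> * coeff (\<phi> j) \<omega>) \<le> measure \<mu> UNIV" if "\<omega> \<in> space P" for \<omega>
      using defect_nonneg[OF that, of n] norm_X_le[OF that] by (simp add: defect_def power2_eq_square)
  qed (simp_all add: coeff_mult_integrable phi_L2)
  finally show "(\<Sum>j<n. lam j) \<le> measure \<mu> UNIV" by (simp add: prob_space)
qed

text \<open>The projection being symmetric, \<open>coeff (resid n g)\<close> is the inner product of \<open>g\<close> with the
  residual of \<open>X\<close>.\<close>

lemma expectation_abs_coeff_resid:
  assumes g: "g \<in> L2 \<mu>"
  shows "expectation (\<lambda>\<omega>. \<bar>coeff (resid n g) \<omega>\<bar>) \<le> sqrt (lam n * L2_inner \<mu> g g)"
proof (rule real_le_rsqrt)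
  let ?Y = "\<lambda>\<omega>. \<bar>coeff (resid n g) \<omega>\<bar>"
  have r: "resid n g \<in> L2 \<mu>" by (rule resid_L2[OF g])
  have i: "integrable P ?Y" "integrable P (\<lambda>\<omega>. (?Y \<omega>)\<^sup>2)"
    using coeff_integrable[OF r] coeff_mult_integrable[OF r r] by (simp_all add: power2_eq_square)
  have "0 \<le> variance ?Y" by (rule integral_nonneg_AE) simp
  then have "(expectation ?Y)\<^sup>2 \<le> expectation (\<lambda>\<omega>. (?Y \<omega>)\<^sup>2)"
    using variance_eq[OF i] by linarith
  also have "\<dots> = L2_inner \<mu> (T (resid n g)) (resid n g)"
    by (simp add: T_inner r power2_eq_square)
  also have "\<dots> \<le> lam n * L2_inner \<mu> (resid n g) (resid n g)"
    by (rule Rayleigh_bound[OF resid_orth[OF g]])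
  also have "\<dots> \<le> lam n * L2_inner \<mu> g g"
    using resid_norm(1)[OF g, of n] by (intro mult_left_mono lam_nonneg) (simp add: sum_nonneg)
  finally show "(expectation ?Y)\<^sup>2 \<le> lam n * L2_inner \<mu> g g" .
qed

text \<open>Step functions on the grid of mesh \<open>1 / (m + 1)\<close>. Only the cells with index up to
  \<open>(m + 1)\<^sup>2\<close> in modulus are used; they cover an interval that grows to the whole line.\<close>

definition cells :: "nat \<Rightarrow> int set" where
  "cells m = {- (int (Suc m))\<^sup>2..(int (Suc m))\<^sup>2}"

definition cell_ind :: "nat \<Rightarrow> int \<Rightarrow> real \<Rightarrow> real" where
  "cell_ind m k x = (if \<lfloor>real (Suc m) * x\<rfloor> = k then 1 else 0)"

text \<open>The path sampled at the right end points of the cells, and zero outside the chosen cells.\<close>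

definition step :: "nat \<Rightarrow> 'a \<Rightarrow> real \<Rightarrow> real" where
  "step m \<omega> x = (\<Sum>k\<in>cells m. X \<omega> ((real_of_int k + 1) / real (Suc m)) * cell_ind m k x)"

lemma finite_cells: "finite (cells m)"
  by (simp add: cells_def)

lemma cell_ind_L2: "cell_ind m k \<in> L2 \<mu>"
  unfolding cell_ind_def[abs_def] by (rule L2_bounded[OF mu_finite, of _ 1]) auto

lemma step_L2: "step m \<omega> \<in> L2 \<mu>"
  unfolding step_def[abs_def] by (intro L2_sum_cmult cell_ind_L2)

lemma step_eq: "step m \<omega> x = (if \<lfloor>real (Suc m) * x\<rfloor> \<in> cells m then X \<omega> (grid m x) else 0)"
  unfolding step_def cell_ind_def grid_def
proof -
  let ?c = "\<lambda>k. X \<omega> ((real_of_int k + 1) / real (Suc m))" and ?j = "\<lfloor>real (Suc m) * x\<rfloor>"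
  have "(\<Sum>k\<in>cells m. ?c k * (if ?j = k then 1 else 0)) = (\<Sum>k\<in>cells m. if ?j = k then ?c k else 0)"
    by (rule sum.cong) simp_all
  also have "\<dots> = (if ?j \<in> cells m then ?c ?j else 0)"
    by (rule sum.delta'[OF finite_cells])
  finally show "(\<Sum>k\<in>cells m. ?c k * (if ?j = k then 1 else 0)) = (if ?j \<in> cells m then ?c ?j else 0)" .
qed

lemma step_abs_le_1: "\<omega> \<in> space P \<Longrightarrow> \<bar>step m \<omega> x\<bar> \<le> 1"
  using X_abs_le_1 by (simp add: step_eq)

lemma eventually_in_cells: "\<forall>\<^sub>F m in sequentially. \<lfloor>real (Suc m) * x\<rfloor> \<in> cells m"
proof -
  obtain N :: nat where N: "\<bar>x\<bar> + 1 < real N" using reals_Archimedean2 by blast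
  show ?thesis
  proof (rule eventually_sequentiallyI[of N])
    fix m assume "N \<le> m"
    define s where "s = real (Suc m)"
    have s: "1 \<le> s" "\<bar>x\<bar> + 1 \<le> s" using N \<open>N \<le> m\<close> by (auto simp: s_def)
    have "\<bar>s * x\<bar> + 1 \<le> s * \<bar>x\<bar> + s" using s by (simp add: abs_mult)
    also have "\<dots> = s * (\<bar>x\<bar> + 1)" by (simp add: algebra_simps)
    also have "\<dots> \<le> s * s" using s by (intro mult_left_mono) auto
    finally have b: "\<bar>s * x\<bar> + 1 \<le> s * s" .
    have e: "real_of_int ((int (Suc m))\<^sup>2) = s * s" by (simp add: s_def power2_eq_square)
    have "- ((int (Suc m))\<^sup>2) \<le> \<lfloor>s * x\<rfloor>"
      using b by (simp add: le_floor_iff e del: of_int_power of_nat_Suc)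
    moreover have "real_of_int \<lfloor>s * x\<rfloor> \<le> real_of_int ((int (Suc m))\<^sup>2)"
      unfolding e using b of_int_floor_le[of "s * x"] by linarith
    ultimately show "\<lfloor>real (Suc m) * x\<rfloor> \<in> cells m"
      unfolding s_def[symmetric] cells_def of_int_le_iff by simp
  qed
qed

lemma step_lim:
  assumes "\<omega> \<in> space P"
  shows "(\<lambda>m. step m \<omega> x) \<longlonglongrightarrow> X \<omega> x"
proof (rule Lim_transform_eventually[OF tendsto_grid[OF X_right_cont[OF assms]]])
  show "\<forall>\<^sub>F m in sequentially. X \<omega> (grid m x) = step m \<omega> x"
    using eventually_in_cells[of x] by eventually_elim (simp only: step_eq if_True)
qed

text \<open>The squared distance in \<open>L\<^sup>2(\<mu>)\<close> between a path and its step function.\<close>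

definition step_error :: "nat \<Rightarrow> 'a \<Rightarrow> real" where
  "step_error m \<omega> = (\<integral>x. (X \<omega> x - step m \<omega> x)\<^sup>2 \<partial>\<mu>)"

lemma step_measurable[measurable]: "(\<lambda>p. step m (fst p) (snd p)) \<in> borel_measurable (P \<Otimes>\<^sub>M \<mu>)"
proof -
  have [measurable]: "cell_ind m k \<in> borel_measurable \<mu>" for k
    by (rule L2_measurable[OF cell_ind_L2])
  show ?thesis unfolding step_def by measurable
qed

lemma step_error_measurable[measurable]: "step_error m \<in> borel_measurable P"
  unfolding step_error_def[abs_def]
  by (rule mu.borel_measurable_lebesgue_integral) (simp add: split_beta')

lemma step_diff_sq_le: "\<omega> \<in> space P \<Longrightarrow> (X \<omega> x - step m \<omega> x)\<^sup>2 \<le> 4"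
proof -
  assume "\<omega> \<in> space P"
  then have "\<bar>X \<omega> x - step m \<omega> x\<bar> \<le> 2"
    using X_abs_le_1[of \<omega> x] step_abs_le_1[of \<omega> m x] by linarith
  then show ?thesis using power_mono[of "\<bar>X \<omega> x - step m \<omega> x\<bar>" 2 2] by simp
qed

lemma step_error_bounds:
  assumes \<omega>: "\<omega> \<in> space P"
  shows "0 \<le> step_error m \<omega>" "step_error m \<omega> \<le> 4 * measure \<mu> UNIV"
proof -
  have "(\<lambda>x. X \<omega> x - step m \<omega> x) \<in> L2 \<mu>" by (intro L2_diff X_L2 \<omega> step_L2)
  then have "step_error m \<omega> \<le> (\<integral>x. 4 \<partial>\<mu>)"
    unfolding step_error_def using step_diff_sq_le[OF \<omega>] by (intro integral_mono) (auto simp: L2_def)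
  then show "step_error m \<omega> \<le> 4 * measure \<mu> UNIV" by (simp add: space_mu)
qed (simp add: step_error_def)

lemma step_error_integrable: "integrable P (step_error m)"
  by (rule integrable_const_bound[of _ "4 * measure \<mu> UNIV"]) (auto simp: step_error_bounds)

lemma expectation_step_error_lim: "(\<lambda>m. expectation (step_error m)) \<longlonglongrightarrow> 0"
proof -
  have lim: "(\<lambda>m. step_error m \<omega>) \<longlonglongrightarrow> 0" if \<omega>: "\<omega> \<in> space P" for \<omega>
  proof -
    have "(\<lambda>m. step_error m \<omega>) \<longlonglongrightarrow> (\<integral>x. 0 \<partial>\<mu>)"
      unfolding step_error_def
    proof (rule integral_dominated_convergence[where w = "\<lambda>_. 4"])
      show "(\<lambda>x. (X \<omega> x - step m \<omega> x)\<^sup>2) \<in> borel_measurable \<mu>" for m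
        using L2_diff[OF X_L2[OF \<omega>] step_L2[of m \<omega>]] by (auto simp: L2_def)
      have "(\<lambda>m. (X \<omega> x - step m \<omega> x)\<^sup>2) \<longlonglongrightarrow> (X \<omega> x - X \<omega> x)\<^sup>2" for x
        by (intro tendsto_intros step_lim \<omega>)
      then show "AE x in \<mu>. (\<lambda>m. (X \<omega> x - step m \<omega> x)\<^sup>2) \<longlonglongrightarrow> 0" by simp
      show "AE x in \<mu>. norm ((X \<omega> x - step m \<omega> x)\<^sup>2) \<le> 4" for m
        using step_diff_sq_le[OF \<omega>] by simp
    qed simp_all
    then show ?thesis by simp
  qed
  have "(\<lambda>m. expectation (step_error m)) \<longlonglongrightarrow> expectation (\<lambda>_. 0)"
    by (rule integral_dominated_convergence[where w = "\<lambda>_. 4 * measure \<mu> UNIV"])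
      (use lim step_error_bounds in \<open>auto intro!: AE_I2\<close>)
  then show ?thesis by simp
qed

text \<open>With \<open>R\<close> the residual of \<open>X\<close> and \<open>d\<close> the difference of \<open>X\<close> and its step function,
  \<open>\<langle>R, R\<rangle> = \<langle>R, X\<rangle>\<close> equals \<open>\<langle>R, step\<rangle> + \<langle>R, d\<rangle>\<close>, and \<open>2 * \<langle>R, d\<rangle> \<le> \<langle>R, R\<rangle> + \<langle>d, d\<rangle>\<close>.\<close>

lemma defect_le_step:
  assumes \<omega>: "\<omega> \<in> space P"
  shows "defect n \<omega> \<le> 2 * (\<Sum>k\<in>cells m. \<bar>coeff (resid n (cell_ind m k)) \<omega>\<bar>) + step_error m \<omega>"
proof -
  let ?R = "resid n (X \<omega>)" and ?d = "\<lambda>x. X \<omega> x - step m \<omega> x"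
  have R: "?R \<in> L2 \<mu>" and d: "?d \<in> L2 \<mu>"
    by (intro resid_L2 L2_diff X_L2 \<omega> step_L2)+
  have e: "step_error m \<omega> = L2_inner \<mu> ?d ?d"
    by (simp add: step_error_def L2_inner_def power2_eq_square)
  have "0 \<le> L2_inner \<mu> (\<lambda>x. ?R x - ?d x) (\<lambda>x. ?R x - ?d x)" by (rule L2_inner_nonneg)
  also have "\<dots> = L2_inner \<mu> ?R ?R - 2 * L2_inner \<mu> ?R ?d + L2_inner \<mu> ?d ?d"
    using L2_inner_diff_left[OF R d L2_diff[OF R d]] L2_inner_diff_right[OF R d R]
      L2_inner_diff_right[OF R d d] L2_inner_commute[of \<mu> ?R ?d] by simp
  also have "L2_inner \<mu> ?R ?d = L2_inner \<mu> ?R (X \<omega>) - L2_inner \<mu> ?R (step m \<omega>)"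
    by (intro L2_inner_diff_right X_L2 step_L2 R \<omega>)
  also have "L2_inner \<mu> ?R (X \<omega>) = L2_inner \<mu> ?R ?R"
    by (rule resid_norm(2)[OF X_L2[OF \<omega>], symmetric])
  finally have "defect n \<omega> \<le> 2 * L2_inner \<mu> ?R (step m \<omega>) + step_error m \<omega>"
    by (simp add: defect_eq_resid[OF \<omega>] e)
  moreover have "L2_inner \<mu> ?R (step m \<omega>) \<le> (\<Sum>k\<in>cells m. \<bar>coeff (resid n (cell_ind m k)) \<omega>\<bar>)"
  proof -
    have "L2_inner \<mu> ?R (step m \<omega>) = L2_inner \<mu> (step m \<omega>) ?R" by (rule L2_inner_commute)
    also have "\<dots> = (\<Sum>k\<in>cells m. X \<omega> ((real_of_int k + 1) / real (Suc m)) * L2_inner \<mu> (cell_ind m k) ?R)"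
      unfolding step_def[abs_def] by (rule L2_inner_sum_left) (intro cell_ind_L2 R)+
    also have "\<dots> \<le> (\<Sum>k\<in>cells m. \<bar>coeff (resid n (cell_ind m k)) \<omega>\<bar>)"
    proof (rule sum_mono)
      fix k
      have "L2_inner \<mu> (cell_ind m k) ?R = coeff (resid n (cell_ind m k)) \<omega>"
        unfolding coeff_def
        using resid_inner_commute[OF cell_ind_L2 X_L2[OF \<omega>]] by (metis L2_inner_commute)
      then show "X \<omega> ((real_of_int k + 1) / real (Suc m)) * L2_inner \<mu> (cell_ind m k) ?R
          \<le> \<bar>coeff (resid n (cell_ind m k)) \<omega>\<bar>"
        using abs_ge_self[of "X \<omega> ((real_of_int k + 1) / real (Suc m)) * coeff (resid n (cell_ind m k)) \<omega>"]
          mult_right_mono[OF X_abs_le_1[OF \<omega>, of "(real_of_int k + 1) / real (Suc m)"]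
            abs_ge_zero[of "coeff (resid n (cell_ind m k)) \<omega>"]]
        by (simp add: abs_mult)
    qed
    finally show ?thesis .
  qed
  ultimately show ?thesis by linarith
qed

text \<open>The mesh \<open>m\<close> is chosen before \<open>n\<close>: for fixed \<open>m\<close> the sum over the cells is finite and each of its
  terms tends to zero with \<open>lam n\<close>.\<close>

lemma expectation_defect_lim: "(\<lambda>n. expectation (defect n)) \<longlonglongrightarrow> 0"
proof (rule LIMSEQ_I)
  fix \<epsilon> :: real assume "0 < \<epsilon>"
  then obtain m where "norm (expectation (step_error m) - 0) < \<epsilon> / 2"
    using LIMSEQ_D[OF expectation_step_error_lim, of "\<epsilon> / 2"] by auto
  then have m: "expectation (step_error m) < \<epsilon> / 2" by simp
  define b where "b n = 2 * (\<Sum>k\<in>cells m. sqrt (lam n * L2_inner \<mu> (cell_ind m k) (cell_ind m k)))" for n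
  have "b \<longlonglongrightarrow> 2 * (\<Sum>k\<in>cells m. sqrt (0 * L2_inner \<mu> (cell_ind m k) (cell_ind m k)))"
    unfolding b_def[abs_def] by (intro tendsto_intros lam_lim)
  then have "b \<longlonglongrightarrow> 0" by simp
  then obtain N where N: "\<And>n. n \<ge> N \<Longrightarrow> \<bar>b n\<bar> < \<epsilon> / 2"
    using LIMSEQ_D[of b 0 "\<epsilon> / 2"] \<open>0 < \<epsilon>\<close> by auto
  have "expectation (defect n) \<le> b n + expectation (step_error m)" for n
  proof -
    have i: "integrable P (\<lambda>\<omega>. \<bar>coeff (resid n (cell_ind m k)) \<omega>\<bar>)" for k
      by (intro integrable_abs coeff_integrable resid_L2 cell_ind_L2)
    have "expectation (defect n) \<le> expectation (\<lambda>\<omega>. 2 * (\<Sum>k\<in>cells m. \<bar>coeff (resid n (cell_ind m k)) \<omega>\<bar>) + step_error m \<omega>)"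
      using i by (intro integral_mono defect_integrable defect_le_step) (auto simp: step_error_integrable)
    also have "\<dots> = 2 * (\<Sum>k\<in>cells m. expectation (\<lambda>\<omega>. \<bar>coeff (resid n (cell_ind m k)) \<omega>\<bar>)) + expectation (step_error m)"
      using i step_error_integrable by simp
    also have "\<dots> \<le> b n + expectation (step_error m)"
      unfolding b_def
      by (intro add_right_mono mult_left_mono sum_mono expectation_abs_coeff_resid cell_ind_L2) simp
    finally show ?thesis .
  qed
  moreover have "0 \<le> expectation (defect n)" for n
    by (rule integral_nonneg_AE) (auto simp: defect_nonneg)
  ultimately have "norm (expectation (defect n) - 0) < \<epsilon>" if "n \<ge> N" for n
    using m N[OF that] by (smt (verit) field_sum_of_halves real_norm_def)
  then show "\<exists>N. \<forall>n\<ge>N. norm (expectation (defect n) - 0) < \<epsilon>" by blast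
qed

theorem defect_AE_lim: "AE \<omega> in P. (\<lambda>n. defect n \<omega>) \<longlonglongrightarrow> 0"
proof -
  define L where "L \<omega> = lim (\<lambda>n. defect n \<omega>)" for \<omega>
  have lim: "(\<lambda>n. defect n \<omega>) \<longlonglongrightarrow> L \<omega>" if "\<omega> \<in> space P" for \<omega>
    unfolding L_def convergent_LIMSEQ_iff[symmetric]
    using decseq_convergent[OF defect_decseq[of \<omega>], of 0] defect_nonneg[OF that]
    by (metis convergentI)
  have L_measurable: "L \<in> borel_measurable P"
    by (rule borel_measurable_LIMSEQ_real[OF lim]) simp_all
  have L: "0 \<le> L \<omega>" "L \<omega> \<le> measure \<mu> UNIV" if "\<omega> \<in> space P" for \<omega>
    using LIMSEQ_le_const[OF lim[OF that], of 0] LIMSEQ_le_const2[OF lim[OF that], of "measure \<mu> UNIV"]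
      defect_nonneg[OF that] defect_le[OF that] by auto
  have "(\<lambda>n. expectation (defect n)) \<longlonglongrightarrow> expectation L"
    by (rule integral_dominated_convergence[where w = "\<lambda>_. measure \<mu> UNIV"])
      (use lim L_measurable defect_nonneg defect_le in \<open>auto intro!: AE_I2\<close>)
  then have "expectation L = 0"
    using expectation_defect_lim by (rule LIMSEQ_unique)
  moreover have "integrable P L"
    by (rule integrable_const_bound[of _ "measure \<mu> UNIV"]) (use L L_measurable in auto)
  ultimately have "AE \<omega> in P. L \<omega> = 0"
    using L by (subst (asm) integral_nonneg_eq_0_iff_AE) auto
  then show ?thesis
    using AE_space by eventually_elim (use lim in force)
qed

lemma AE_L2_sums: "AE \<omega> in P. L2_sums \<mu> (\<lambda>j x. coeff (\<phi> j) \<omega> * \<phi> j x) (X \<omega>)"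
  using defect_AE_lim AE_space
proof eventually_elim
  case (elim \<omega>)
  have "(\<lambda>n. sqrt (defect n \<omega>)) \<longlonglongrightarrow> sqrt 0"
    by (intro tendsto_intros elim)
  then show ?case
    unfolding L2_sums_def L2_norm_def
    using elim X_L2 phi_L2
    by (auto simp: L2_cmult defect_eq_resid resid_def[abs_def] coeff_def)
qed

end

section \<open>Bounded cadlag eigenfunctions\<close>

lemma mono_bounded_left_limit:
  fixes f :: "real \<Rightarrow> real"
  assumes f: "mono f" and b: "\<And>x. f x \<le> B"
  shows "\<exists>l. (f \<longlongrightarrow> l) (at_left x)"
proof
  let ?l = "SUP y\<in>{..<x}. f y"
  have bdd: "bdd_above (f ` {..<x})" by (rule bdd_aboveI2[of _ _ B]) (rule b)
  show "(f \<longlongrightarrow> ?l) (at_left x)"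
  proof (rule order_tendstoI)
    fix a assume "a < ?l"
    then obtain y where y: "y < x" "a < f y"
      using less_cSUP_iff[OF _ bdd, of a] by auto
    have "\<forall>\<^sub>F z in at_left x. z \<in> {y<..<x}"
      by (rule eventually_at_left_real[OF y(1)])
    then show "\<forall>\<^sub>F z in at_left x. a < f z"
      by eventually_elim (use y(2) monoD[OF f, of y] in \<open>auto intro: less_le_trans\<close>)
  next
    fix a assume a: "?l < a"
    have "\<forall>\<^sub>F z in at_left x. z < x" by (simp add: eventually_at_filter)
    then show "\<forall>\<^sub>F z in at_left x. f z < a"
      by eventually_elim (use a cSUP_upper[OF _ bdd] in \<open>auto intro: le_less_trans\<close>)
  qed
qed

text \<open>Finitely many linear functionals on polynomials vanish together on a nonzero polynomial. Its
  degree is kept unbounded to make the induction work: of two common zeros of different degrees, a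
  combination that kills one more functional still has the larger degree.\<close>

lemma poly_orthogonal_high_degree:
  fixes \<kappa> :: "nat \<Rightarrow> real poly \<Rightarrow> real"
  assumes add: "\<And>i p q. \<kappa> i (p + q) = \<kappa> i p + \<kappa> i q"
    and smult: "\<And>i c p. \<kappa> i (smult c p) = c * \<kappa> i p"
  shows "\<exists>p. degree p > d \<and> (\<forall>i<n. \<kappa> i p = 0)"
proof (induction n arbitrary: d)
  case 0
  have "degree (monom (1::real) (Suc d)) = Suc d" by (rule degree_monom_eq) simp
  then show ?case by (intro exI[of _ "monom 1 (Suc d)"]) simp
next
  case (Suc n)
  obtain p where p: "degree p > d" "\<forall>i<n. \<kappa> i p = 0" using Suc by blast
  obtain q where q: "degree q > degree p" "\<forall>i<n. \<kappa> i q = 0" using Suc by blast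
  show ?case
  proof (cases "\<kappa> n p = 0")
    case True
    then show ?thesis using p by (auto simp: less_Suc_eq)
  next
    case False
    let ?c = "- \<kappa> n q / \<kappa> n p"
    have "degree (smult ?c p) < degree q"
      using q(1) degree_smult_le[of ?c p] by linarith
    then have "degree (smult ?c p + q) = degree q" by (rule degree_add_eq_right)
    then have "d < degree (smult ?c p + q)" using p(1) q(1) by simp
    moreover have "\<kappa> i (smult ?c p + q) = 0" if "i < Suc n" for i
    proof -
      have "\<kappa> i (smult ?c p + q) = ?c * \<kappa> i p + \<kappa> i q" by (simp only: add smult)
      then show ?thesis using that p(2) q(2) False by (cases "i = n") (simp_all del: smult_minus_left)
    qed
    ultimately show ?thesis by blast
  qed
qed

lemma poly_arctan_bounded: "\<exists>B. \<forall>x. \<bar>poly p (arctan x)\<bar> \<le> B"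
proof -
  have "compact ((\<lambda>y. poly p y) ` {- 2..2::real})"
    by (intro compact_continuous_image continuous_intros compact_Icc)
  then have "bounded ((\<lambda>y. poly p y) ` {- 2..2})" by (rule compact_imp_bounded)
  then obtain B where "\<forall>y\<in>{- 2..2}. \<bar>poly p y\<bar> \<le> B"
    unfolding bounded_iff by auto
  moreover have "arctan x \<in> {- 2..2}" for x
    using arctan_bounded[of x] pi_half_less_two by auto
  ultimately show ?thesis by blast
qed

lemma cadlag_continuous:
  assumes "continuous_on UNIV f" shows "cadlag f"
proof -
  have "isCont f x" for x using assms by (simp add: continuous_on_eq_continuous_at)
  then show ?thesis
    unfolding cadlag_def continuous_within
    by (meson at_le filterlim_at_split isCont_def)
qed

lemma cadlag_cmult:
  assumes "cadlag f" shows "cadlag (\<lambda>x. c * f x)"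
  unfolding cadlag_def
proof (intro allI conjI)
  fix x
  show "continuous (at_right x) (\<lambda>x. c * f x)"
    using assms by (intro continuous_intros) (simp add: cadlag_def)
  obtain l where "(f \<longlongrightarrow> l) (at_left x)" using assms by (auto simp: cadlag_def)
  then show "\<exists>l. ((\<lambda>x. c * f x) \<longlongrightarrow> l) (at_left x)"
    by (intro exI[of _ "c * l"] tendsto_mult_left)
qed

lemma (in random_cdf) T_cadlag:
  assumes f: "f \<in> L2 \<mu>"
  shows "cadlag (T f)"
proof -
  let ?B = "\<integral>y. \<bar>f y\<bar> \<partial>\<mu>"
  define U where "U x = expectation (\<lambda>\<omega>. F \<omega> x * max (coeff f \<omega>) 0)" for x
  define V where "V x = expectation (\<lambda>\<omega>. F \<omega> x * max (- coeff f \<omega>) 0)" for x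
  have [measurable]: "coeff f \<in> borel_measurable P" using f by simp
  have W: "\<And>\<omega>. \<omega> \<in> space P \<Longrightarrow> max (coeff f \<omega>) 0 \<le> ?B" "\<And>\<omega>. \<omega> \<in> space P \<Longrightarrow> max (- coeff f \<omega>) 0 \<le> ?B"
    using coeff_bound[OF f] by (auto simp: abs_le_iff)
  have U: "mono U" "continuous (at_right x) U" "U x \<le> ?B" for x
    using weighted_mean[of "\<lambda>\<omega>. max (coeff f \<omega>) 0" ?B] W unfolding U_def[abs_def] by auto
  have V: "mono V" "continuous (at_right x) V" "V x \<le> ?B" for x
    using weighted_mean[of "\<lambda>\<omega>. max (- coeff f \<omega>) 0" ?B] W unfolding V_def[abs_def] by auto
  have T: "T f = (\<lambda>x. U x - V x)" unfolding U_def V_def by (rule ext) (rule T_decomposition[OF f])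
  show ?thesis
    unfolding cadlag_def
  proof (intro allI conjI)
    fix x
    show "continuous (at_right x) (T f)" unfolding T by (intro continuous_intros U V)
    obtain l where "(U \<longlongrightarrow> l) (at_left x)" using mono_bounded_left_limit[OF U(1,3)] by blast
    moreover obtain l' where "(V \<longlongrightarrow> l') (at_left x)" using mono_bounded_left_limit[OF V(1,3)] by blast
    ultimately show "\<exists>l. (T f \<longlongrightarrow> l) (at_left x)" unfolding T by (blast intro: tendsto_diff)
  qed
qed

context random_cdf_eigensystem begin

lemma not_AE_False: "\<not> (AE x in \<mu>. False)"
proof
  assume "AE x in \<mu>. False"
  then have "AE x in \<mu>. \<phi> 0 x = 0" by eventually_elim simp
  then have "L2_inner \<mu> (\<phi> 0) (\<phi> 0) = 0" by (simp add: L2_inner_eq_0_iff phi_L2)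
  then show False by (simp add: phi_orthonormal)
qed

lemma poly_arctan_L2: "(\<lambda>x. poly p (arctan x)) \<in> L2 \<mu>"
proof -
  obtain B where "\<And>x. \<bar>poly p (arctan x)\<bar> \<le> B" using poly_arctan_bounded by blast
  moreover have "(\<lambda>x. poly p (arctan x)) \<in> borel_measurable borel"
    by (intro borel_measurable_continuous_onI continuous_intros)
  then have "(\<lambda>x. poly p (arctan x)) \<in> borel_measurable \<mu>"
    by (simp add: measurable_cong_sets[OF sets_mu refl])
  ultimately show ?thesis by (intro L2_bounded[OF mu_finite])
qed

lemma poly_arctan_norm_pos:
  assumes "p \<noteq> 0"
  shows "0 < L2_inner \<mu> (\<lambda>x. poly p (arctan x)) (\<lambda>x. poly p (arctan x))"
proof -
  have "{x. poly p (arctan x) = 0} \<subseteq> tan ` {y. poly p y = 0}"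
    by (force simp: image_iff tan_arctan intro: exI[of _ "arctan _"])
  then have "finite {x. poly p (arctan x) = 0}"
    using poly_roots_finite[OF assms] finite_subset by blast
  then have c: "countable {x. poly p (arctan x) = 0}" by (rule countable_finite)
  have "L2_inner \<mu> (\<lambda>x. poly p (arctan x)) (\<lambda>x. poly p (arctan x)) \<noteq> 0"
  proof
    assume "L2_inner \<mu> (\<lambda>x. poly p (arctan x)) (\<lambda>x. poly p (arctan x)) = 0"
    then have "AE x in \<mu>. poly p (arctan x) = 0"
      by (simp add: L2_inner_eq_0_iff[OF poly_arctan_L2])
    moreover have "AE x in \<mu>. poly p (arctan x) \<noteq> 0"
    proof (rule AE_I[where N = "{x. poly p (arctan x) = 0}"])
      show "{x. poly p (arctan x) = 0} \<in> sets \<mu>"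
        unfolding sets_mu by (rule sets.countable[OF _ c]) simp
    qed (use no_atoms[OF c] in auto)
    ultimately have "AE x in \<mu>. False" by eventually_elim simp
    then show False using not_AE_False by blast
  qed
  then show ?thesis using L2_inner_nonneg[of \<mu> "\<lambda>x. poly p (arctan x)"] by linarith
qed

text \<open>Bounded cadlag functions are plentiful enough to extend any finite family. A nonzero
  polynomial in \<open>arctan\<close> has finitely many zeros, hence positive norm, as \<open>\<mu>\<close> has no atoms and is
  not zero.\<close>

lemma exists_bounded_cadlag_orthonormal:
  fixes g :: "nat \<Rightarrow> real \<Rightarrow> real"
  assumes g: "\<And>i. i < n \<Longrightarrow> g i \<in> L2 \<mu>"
  shows "\<exists>r. r \<in> L2 \<mu> \<and> bounded (range r) \<and> cadlag r \<and> L2_inner \<mu> r r = 1 \<and> (\<forall>i<n. L2_inner \<mu> r (g i) = 0)"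
proof -
  define g' where "g' i = (if i < n then g i else (\<lambda>_. 0))" for i
  have g': "g' i \<in> L2 \<mu>" for i using g by (simp add: g'_def L2_def)
  define \<kappa> where "\<kappa> i p = L2_inner \<mu> (\<lambda>x. poly p (arctan x)) (g' i)" for i :: nat and p
  have "\<kappa> i (p + q) = \<kappa> i p + \<kappa> i q" for i p q
    unfolding \<kappa>_def poly_add by (intro L2_inner_add_left poly_arctan_L2 g')
  moreover have "\<kappa> i (smult c p) = c * \<kappa> i p" for i c p
    unfolding \<kappa>_def poly_smult by (rule L2_inner_cmult_left)
  ultimately obtain p where p: "degree p > 0" "\<forall>i<n. \<kappa> i p = 0"
    using poly_orthogonal_high_degree[of \<kappa> 0 n] by auto
  then have "p \<noteq> 0" by auto
  let ?f = "\<lambda>x. poly p (arctan x)"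
  define d where "d = L2_inner \<mu> ?f ?f"
  have d: "0 < d" unfolding d_def by (rule poly_arctan_norm_pos[OF \<open>p \<noteq> 0\<close>])
  let ?r = "\<lambda>x. 1 / sqrt d * ?f x"
  obtain B where B: "\<And>x. \<bar>?f x\<bar> \<le> B" using poly_arctan_bounded by blast
  show ?thesis
  proof (intro exI[of _ ?r] conjI allI impI)
    show "?r \<in> L2 \<mu>" by (intro L2_cmult poly_arctan_L2)
    show "bounded (range ?r)"
    proof (rule boundedI[of _ "1 / sqrt d * B"])
      fix y assume "y \<in> range ?r"
      then show "norm y \<le> 1 / sqrt d * B"
        using B d by (auto simp: abs_mult divide_right_mono)
    qed
    show "cadlag ?r" by (intro cadlag_continuous continuous_intros)
    have "L2_inner \<mu> ?r ?r = 1 / sqrt d * (1 / sqrt d * d)"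
      unfolding d_def by (simp only: L2_inner_cmult_left L2_inner_cmult_right)
    then show "L2_inner \<mu> ?r ?r = 1" using d by simp
    fix i assume "i < n"
    then have "L2_inner \<mu> ?f (g i) = 0" using p(2) by (simp add: \<kappa>_def g'_def)
    then show "L2_inner \<mu> ?r (g i) = 0" by (simp only: L2_inner_cmult_left mult_zero_right)
  qed
qed

text \<open>The new system is chosen recursively. As the eigenvalues decrease, all functions chosen
  before one with \<open>lam j \<noteq> 0\<close> agree with the given eigenfunctions, so orthogonality is
  automatic there; for \<open>lam j = 0\<close> any bounded cadlag unit vector orthogonal to the previous ones
  is admissible.\<close>

lemma exists_cadlag_system:
  "\<exists>\<psi>. \<forall>j. \<psi> j \<in> L2 \<mu> \<and> bounded (range (\<psi> j)) \<and> cadlag (\<psi> j) \<and> L2_inner \<mu> (\<psi> j) (\<psi> j) = 1 \<and>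
     (\<forall>i<j. L2_inner \<mu> (\<psi> j) (\<psi> i) = 0) \<and> (lam j \<noteq> 0 \<longrightarrow> (AE x in \<mu>. \<psi> j x = \<phi> j x))"
proof -
  let ?Q = "\<lambda>\<psi> j r. r \<in> L2 \<mu> \<and> bounded (range r) \<and> cadlag r \<and> L2_inner \<mu> r r = 1 \<and>
     (\<forall>i<j. L2_inner \<mu> r (\<psi> i) = 0) \<and> (lam j \<noteq> 0 \<longrightarrow> (AE x in \<mu>. r x = \<phi> j x))"
  show ?thesis
  proof (rule dependent_wellorder_choice[of ?Q])
    fix j :: nat and \<psi> :: "nat \<Rightarrow> real \<Rightarrow> real"
    assume prev: "\<And>i. i < j \<Longrightarrow> ?Q \<psi> i (\<psi> i)"
    show "\<exists>r. ?Q \<psi> j r"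
    proof (cases "lam j = 0")
      case True
      then show ?thesis using exists_bounded_cadlag_orthonormal[of j \<psi>] prev by auto
    next
      case False
      let ?r = "\<lambda>x. inverse (lam j) * T (\<phi> j) x"
      have r: "?r \<in> L2 \<mu>" by (intro L2_cmult T_L2 phi_L2)
      have ae: "AE x in \<mu>. ?r x = \<phi> j x"
        using phi_eigen[of j] by eventually_elim (use False in simp)
      have "L2_inner \<mu> ?r (\<psi> i) = 0" if "i < j" for i
      proof -
        have "lam j \<le> lam i" using lam_decseq that by (simp add: decseq_def)
        then have "lam i \<noteq> 0" using False lam_nonneg[of j] by linarith
        then have "L2_inner \<mu> ?r (\<psi> i) = L2_inner \<mu> (\<phi> j) (\<phi> i)"
          using prev[OF that] r ae by (intro L2_inner_cong_AE phi_L2) auto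
        then show ?thesis using that by (simp add: phi_orthonormal)
      qed
      moreover have "L2_inner \<mu> ?r ?r = L2_inner \<mu> (\<phi> j) (\<phi> j)"
        by (intro L2_inner_cong_AE phi_L2 r ae)
      then have "L2_inner \<mu> ?r ?r = 1" by (simp add: phi_orthonormal)
      moreover have "bounded (range ?r)"
      proof (rule boundedI[of _ "\<bar>inverse (lam j)\<bar> * (\<integral>y. \<bar>\<phi> j y\<bar> \<partial>\<mu>)"])
        fix y assume "y \<in> range ?r"
        then obtain x where y: "y = ?r x" by blast
        show "norm y \<le> \<bar>inverse (lam j)\<bar> * (\<integral>y. \<bar>\<phi> j y\<bar> \<partial>\<mu>)"
          unfolding y real_norm_def abs_mult by (intro mult_left_mono T_bound phi_L2) simp
      qed
      moreover have "cadlag ?r" by (intro cadlag_cmult T_cadlag phi_L2)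
      ultimately show ?thesis using r ae by blast
    qed
  qed auto
qed

theorem exists_cadlag_eigenfunctions:
  "\<exists>\<psi>. (\<forall>j. \<psi> j \<in> L2 \<mu>) \<and> (\<forall>j. AE x in \<mu>. T (\<psi> j) x = lam j * \<psi> j x) \<and>
     (\<forall>i j. L2_inner \<mu> (\<psi> i) (\<psi> j) = (if i = j then 1 else 0)) \<and>
     (\<forall>j. lam j \<noteq> 0 \<longrightarrow> (AE x in \<mu>. \<psi> j x = \<phi> j x)) \<and>
     (\<forall>j. bounded (range (\<psi> j)) \<and> cadlag (\<psi> j))"
proof -
  obtain \<psi> where L2: "\<And>j. \<psi> j \<in> L2 \<mu>" and reg: "\<And>j. bounded (range (\<psi> j)) \<and> cadlag (\<psi> j)"
    and norm: "\<And>j. L2_inner \<mu> (\<psi> j) (\<psi> j) = 1" and orth: "\<And>i j. i < j \<Longrightarrow> L2_inner \<mu> (\<psi> j) (\<psi> i) = 0"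
    and ae: "\<And>j. lam j \<noteq> 0 \<Longrightarrow> AE x in \<mu>. \<psi> j x = \<phi> j x"
    using exists_cadlag_system by metis
  have ortho: "L2_inner \<mu> (\<psi> i) (\<psi> j) = (if i = j then 1 else 0)" for i j
    using norm orth[of i j] orth[of j i] L2_inner_commute[of \<mu> "\<psi> i" "\<psi> j"]
    by (cases i j rule: linorder_cases) auto
  have eigen: "AE x in \<mu>. T (\<psi> j) x = lam j * \<psi> j x" for j
  proof (cases "lam j = 0")
    case False
    then have eq: "T (\<psi> j) = T (\<phi> j)" by (intro T_cong_AE ae L2 phi_L2)
    show ?thesis unfolding eq using phi_eigen[of j] ae[OF False] by eventually_elim simp
  next
    case True
    \<comment> \<open>The functions before the first zero eigenvalue are unchanged, so \<open>\<psi> j\<close> is orthogonal to them and the Rayleigh bound there is zero.\<close>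
    define n where "n = (LEAST k. lam k = 0)"
    have n: "lam n = 0" unfolding n_def by (rule LeastI[of _ j]) (rule True)
    have less: "lam i \<noteq> 0" if "i < n" for i using not_less_Least that unfolding n_def by blast
    have "\<psi> j \<in> orth n"
      unfolding orth_def
    proof (intro CollectI conjI allI impI L2)
      fix i assume i: "i < n"
      have "L2_inner \<mu> (\<psi> j) (\<phi> i) = L2_inner \<mu> (\<psi> j) (\<psi> i)"
        using ae[OF less[OF i]] by (intro L2_inner_cong_AE L2 phi_L2) auto
      also have "\<dots> = 0" using less[OF i] True by (auto simp: ortho)
      finally show "L2_inner \<mu> (\<psi> j) (\<phi> i) = 0" .
    qed
    then have "L2_inner \<mu> (T (\<psi> j)) (\<psi> j) \<le> 0" using Rayleigh_bound n by fastforce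
    then have "L2_inner \<mu> (T (\<psi> j)) (\<psi> j) = 0" using T_inner_nonneg[OF L2, of j] by linarith
    then have "(L2_inner \<mu> (T (\<psi> j)) (T (\<psi> j)))\<^sup>2 \<le> 0"
      using T_form_Cauchy_Schwarz[OF L2 T_L2[OF L2], of j j] by simp
    then have "L2_inner \<mu> (T (\<psi> j)) (T (\<psi> j)) = 0" by simp
    then have "AE x in \<mu>. T (\<psi> j) x = 0" by (simp add: L2_inner_eq_0_iff T_L2 L2)
    then show ?thesis using True by simp
  qed
  show ?thesis using L2 eigen ortho ae reg by blast
qed

end

section \<open>The expansion of a stationary sequence of random measures\<close>

text \<open>Countable sets are null for Lebesgue measure, which dominates a diffraction.\<close>

lemma diffraction_no_atoms:
  assumes "diffraction P \<xi> \<mu>" "countable A"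
  shows "emeasure \<mu> A = 0"
proof -
  obtain I :: "real set" where I: "is_interval I"
    and ac: "absolutely_continuous (density lborel (indicator I)) \<mu>"
    using assms(1) by (auto simp: diffraction_def)
  have [measurable]: "I \<in> sets borel" using I by (rule real_interval_borel_measurable)
  have "absolutely_continuous lborel (density lborel (indicator I))"
    by (rule absolutely_continuousI_density) simp
  moreover have "A \<in> null_sets lborel" using assms(2) by (rule countable_imp_null_set_lborel)
  ultimately have "A \<in> null_sets \<mu>" using ac by (auto simp: absolutely_continuous_def)
  then show ?thesis by auto
qed

lemma random_cdf_of_random_measures:
  assumes "prob_space P" and stat: "stationary_random_measures P \<xi>" and diff: "diffraction P \<xi> \<mu>"
  shows "random_cdf P \<mu> (\<lambda>\<omega>. cdf (\<xi> t \<omega>)) (cdf (baricenter P (\<xi> 0))) (C0 P \<xi>)"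
proof -
  interpret prob_space P by fact
  let ?G = "cdf (baricenter P (\<xi> 0))"
  have \<xi>: "\<xi> s \<in> measurable P M1" for s using stat by (simp add: stationary_random_measures_def)
  note [measurable] = cdf_measurable_M1
  have mean0: "expectation (\<lambda>\<omega>. cdf (\<xi> 0 \<omega>) x) = ?G x" for x
    by (rule cdf_baricenter[OF \<xi>, symmetric])
  show ?thesis
    unfolding random_cdf_def random_cdf_axioms_def
  proof (intro conjI allI impI)
    show "prob_space P" by fact
    show "finite_measure \<mu>" "sets \<mu> = sets borel" using diff by (simp_all add: diffraction_def)
    show "(\<lambda>\<omega>. cdf (\<xi> t \<omega>) x) \<in> borel_measurable P" for x
      using \<xi> cdf_measurable_M1 by (rule measurable_compose)
    show "expectation (\<lambda>\<omega>. cdf (\<xi> t \<omega>) x) = ?G x" for x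
      using stationary_expectation[OF stat cdf_measurable_M1, of t x] mean0[of x] by simp
    have h: "(\<lambda>\<nu>. (cdf \<nu> x - ?G x) * (cdf \<nu> y - ?G y)) \<in> borel_measurable M1" for x y
      by measurable
    show "C0 P \<xi> x y = expectation (\<lambda>\<omega>. (cdf (\<xi> t \<omega>) x - ?G x) * (cdf (\<xi> t \<omega>) y - ?G y))" for x y
      unfolding stationary_expectation[OF stat h, of t] C0_def covariance_def mean0 ..
  next
    fix \<omega> assume \<omega>: "\<omega> \<in> space P"
    interpret \<xi>: real_distribution "\<xi> t \<omega>" by (rule random_measure_real_distribution[OF \<xi> \<omega>])
    show "mono (cdf (\<xi> t \<omega>))" by (intro monoI \<xi>.cdf_nondecreasing)
    show "continuous (at_right x) (cdf (\<xi> t \<omega>))" for x by (rule \<xi>.cdf_is_right_cont)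
    show "0 \<le> cdf (\<xi> t \<omega>) x" "cdf (\<xi> t \<omega>) x \<le> 1" for x
      by (rule \<xi>.cdf_nonneg \<xi>.cdf_bounded_prob)+
  qed
qed

theorem theorem2:
  fixes P :: "'a measure" and \<xi> :: "nat \<Rightarrow> 'a \<Rightarrow> real measure" and \<mu> :: "real measure"
    and lam :: "nat \<Rightarrow> real" and \<phi> :: "nat \<Rightarrow> real \<Rightarrow> real"
  assumes "prob_space P"
    and "stationary_random_measures P \<xi>"
    and "diffraction P \<xi> \<mu>"
    and "eigensystem P \<xi> \<mu> lam \<phi>"
  shows
    "(\<forall>t j. integrable P (Z P \<xi> \<mu> \<phi> t j) \<and> prob_space.expectation P (Z P \<xi> \<mu> \<phi> t j) = 0) \<and>
     (\<forall>t j. integrable P (\<lambda>\<omega>. (Z P \<xi> \<mu> \<phi> t j \<omega>)\<^sup>2) \<and>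
        prob_space.variance P (Z P \<xi> \<mu> \<phi> t j) = lam j) \<and>
     (\<forall>t i j. i \<noteq> j \<longrightarrow> covariance P (Z P \<xi> \<mu> \<phi> t i) (Z P \<xi> \<mu> \<phi> t j) = 0) \<and>
     (\<exists>\<psi>. eigensystem P \<xi> \<mu> lam \<psi> \<and>
        (\<forall>j. lam j \<noteq> 0 \<longrightarrow> (AE x in \<mu>. \<psi> j x = \<phi> j x)) \<and>
        (\<forall>j. bounded (range (\<psi> j)) \<and> cadlag (\<psi> j))) \<and>
     (\<forall>t. AE \<omega> in P. L2_sums \<mu> (\<lambda>j x. Z P \<xi> \<mu> \<phi> t j \<omega> * \<phi> j x)
        (\<lambda>x. cdf (\<xi> t \<omega>) x - cdf (baricenter P (\<xi> 0)) x))"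
proof -
  interpret prob_space P by fact
  have eig: "random_cdf_eigensystem P \<mu> (\<lambda>\<omega>. cdf (\<xi> t \<omega>)) (cdf (baricenter P (\<xi> 0))) (C0 P \<xi>) lam \<phi>" for t
  proof -
    interpret random_cdf P \<mu> "\<lambda>\<omega>. cdf (\<xi> t \<omega>)" "cdf (baricenter P (\<xi> 0))" "C0 P \<xi>"
      by (rule random_cdf_of_random_measures[OF assms(1-3)])
    have T: "T f = C0_op P \<xi> \<mu> f" for f by (rule ext) (simp add: T_def C0_op_def)
    show ?thesis
    proof (unfold_locales, goal_cases)
      case 1
      then show ?case by (rule diffraction_no_atoms[OF assms(3)])
    qed (use assms(4) in \<open>auto simp: eigensystem_def eigenspace_def T\<close>)
  qed
  have Z: "Z P \<xi> \<mu> \<phi> t j = random_cdf.coeff \<mu> (\<lambda>\<omega>. cdf (\<xi> t \<omega>)) (cdf (baricenter P (\<xi> 0))) (\<phi> j)" for t j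
  proof -
    interpret random_cdf_eigensystem P \<mu> "\<lambda>\<omega>. cdf (\<xi> t \<omega>)" "cdf (baricenter P (\<xi> 0))" "C0 P \<xi>" lam \<phi>
      by (rule eig)
    show ?thesis by (rule ext) (simp add: Z_def coeff_def X_def[abs_def])
  qed
  have moments: "integrable P (Z P \<xi> \<mu> \<phi> t j)" "expectation (Z P \<xi> \<mu> \<phi> t j) = 0"
    "integrable P (\<lambda>\<omega>. (Z P \<xi> \<mu> \<phi> t j \<omega>)\<^sup>2)"
    "expectation (\<lambda>\<omega>. Z P \<xi> \<mu> \<phi> t i \<omega> * Z P \<xi> \<mu> \<phi> t j \<omega>) = (if i = j then lam j else 0)"
    "AE \<omega> in P. L2_sums \<mu> (\<lambda>j x. Z P \<xi> \<mu> \<phi> t j \<omega> * \<phi> j x) (\<lambda>x. cdf (\<xi> t \<omega>) x - cdf (baricenter P (\<xi> 0)) x)" for t i j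
  proof -
    interpret random_cdf_eigensystem P \<mu> "\<lambda>\<omega>. cdf (\<xi> t \<omega>)" "cdf (baricenter P (\<xi> 0))" "C0 P \<xi>" lam \<phi>
      by (rule eig)
    show "integrable P (Z P \<xi> \<mu> \<phi> t j)" "expectation (Z P \<xi> \<mu> \<phi> t j) = 0"
      "integrable P (\<lambda>\<omega>. (Z P \<xi> \<mu> \<phi> t j \<omega>)\<^sup>2)"
      "expectation (\<lambda>\<omega>. Z P \<xi> \<mu> \<phi> t i \<omega> * Z P \<xi> \<mu> \<phi> t j \<omega>) = (if i = j then lam j else 0)"
      unfolding Z power2_eq_square
      by (rule coeff_integrable expectation_coeff coeff_mult_integrable coeff_phi_covariance phi_L2)+
    show "AE \<omega> in P. L2_sums \<mu> (\<lambda>j x. Z P \<xi> \<mu> \<phi> t j \<omega> * \<phi> j x) (\<lambda>x. cdf (\<xi> t \<omega>) x - cdf (baricenter P (\<xi> 0)) x)"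
      unfolding Z using AE_L2_sums by (simp add: X_def[abs_def])
  qed
  have "\<exists>\<psi>. eigensystem P \<xi> \<mu> lam \<psi> \<and> (\<forall>j. lam j \<noteq> 0 \<longrightarrow> (AE x in \<mu>. \<psi> j x = \<phi> j x)) \<and>
      (\<forall>j. bounded (range (\<psi> j)) \<and> cadlag (\<psi> j))"
  proof -
    interpret random_cdf_eigensystem P \<mu> "\<lambda>\<omega>. cdf (\<xi> 0 \<omega>)" "cdf (baricenter P (\<xi> 0))" "C0 P \<xi>" lam \<phi>
      by (rule eig)
    have T: "T f = C0_op P \<xi> \<mu> f" for f by (rule ext) (simp add: T_def C0_op_def)
    obtain \<psi> where \<psi>: "\<forall>j. \<psi> j \<in> L2 \<mu>" "\<forall>j. AE x in \<mu>. T (\<psi> j) x = lam j * \<psi> j x"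
      "\<forall>i j. L2_inner \<mu> (\<psi> i) (\<psi> j) = (if i = j then 1 else 0)"
      and ae: "\<forall>j. lam j \<noteq> 0 \<longrightarrow> (AE x in \<mu>. \<psi> j x = \<phi> j x)"
      and reg: "\<forall>j. bounded (range (\<psi> j)) \<and> cadlag (\<psi> j)"
      using exists_cadlag_eigenfunctions by blast
    have "\<exists>J a. finite J \<and> J \<subseteq> {j. lam j = c} \<and> (AE x in \<mu>. f x = (\<Sum>j\<in>J. a j * \<psi> j x))"
      if c: "c \<noteq> 0" and f: "f \<in> eigenspace P \<xi> \<mu> c" for c f
    proof -
      obtain J a where J: "finite J" "J \<subseteq> {j. lam j = c}" and fJ: "AE x in \<mu>. f x = (\<Sum>j\<in>J. a j * \<phi> j x)"
        using c f assms(4) unfolding eigensystem_def by blast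
      have "AE x in \<mu>. \<forall>j\<in>J. \<psi> j x = \<phi> j x"
        using J c ae by (intro AE_finite_allI) auto
      with fJ have "AE x in \<mu>. f x = (\<Sum>j\<in>J. a j * \<psi> j x)"
        by eventually_elim (simp cong: sum.cong)
      then show ?thesis using J by blast
    qed
    then have "eigensystem P \<xi> \<mu> lam \<psi>"
      using assms(4) \<psi> unfolding eigensystem_def eigenspace_def T by blast
    then show ?thesis using ae reg by blast
  qed
  moreover have "covariance P (Z P \<xi> \<mu> \<phi> t i) (Z P \<xi> \<mu> \<phi> t j) = 0" if "i \<noteq> j" for t i j
    using that moments(2,4) by (simp add: covariance_def)
  moreover have "variance (Z P \<xi> \<mu> \<phi> t j) = lam j" for t j
    using moments(4)[of t j j] by (simp add: moments(2) power2_eq_square)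
  ultimately show ?thesis using moments(1,2,3,5) by blast
qed

end
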